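(* Let $R$ be a Noetherian integral domain, let $f_1,\ldots,f_n,f\in R$, put $h=f_1T_1+\cdots+f_nT_n+f\in R[T_1,\ldots,T_n]$, $A=R[T_1,\ldots,T_n]/(h)$ and $J=(f,f_1,\ldots,f_n)\subseteq R$. Assume that $\operatorname{ht} J\geq 2$. Then $A$ is an irreducible ring.
   Context: A ring is called irreducible if it has exactly one minimal prime ideal. The height $\operatorname{ht} J$ is the minimum of the heights of the prime ideals containing $J$; it is considered only for proper ideals, so the hypothesis $\operatorname{ht} J\ge 2$ includes $J\neq R$. *)

theory Defs
  imports "HOL-Algebra.Algebra" "HOL-Library.Extended_Nat"
begin

text \<open>
  The polynomial ring over \<open>R\<close> in the variables indexed by \<open>V\<close>, on the library's carrier
  \<open>indexed_pset\<close> of indexed polynomials, i.e. coefficient functions on monomials, a monomial being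
  a finite multiset of variables.  The product is convolution of coefficients: the coefficient at
  \<open>m\<close> is the sum over all factorisations \<open>m = a + (m - a)\<close> of \<open>m\<close> into two monomials.
\<close>

definition (in ring) indexed_mult ::
    "('v multiset \<Rightarrow> 'a) \<Rightarrow> ('v multiset \<Rightarrow> 'a) \<Rightarrow> ('v multiset \<Rightarrow> 'a)"
  where "indexed_mult P Q = (\<lambda>m. \<Oplus>a\<in>{a. a \<subseteq># m}. P a \<otimes> Q (m - a))"

definition (in ring) mpoly_ring :: "'v set \<Rightarrow> ('v multiset \<Rightarrow> 'a) ring"
  where "mpoly_ring V =
    \<lparr> carrier = indexed_pset V (carrier R),
      monoid.mult = indexed_mult,
      one = indexed_const \<one>,
      ring.zero = indexed_const \<zero>,
      ring.add = indexed_padd \<rparr>"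

definition minimal_prime_ideal :: "'a set \<Rightarrow> ('a, 'b) ring_scheme \<Rightarrow> bool"
  where "minimal_prime_ideal P R \<longleftrightarrow>
    primeideal P R \<and> (\<forall>Q. primeideal Q R \<and> Q \<subseteq> P \<longrightarrow> Q = P)"

definition irreducible_ring :: "('a, 'b) ring_scheme \<Rightarrow> bool"
  where "irreducible_ring R \<longleftrightarrow> (\<exists>!P. minimal_prime_ideal P R)"

definition prime_height :: "('a, 'b) ring_scheme \<Rightarrow> 'a set \<Rightarrow> enat"
  where "prime_height R P = Sup {enat k | k. \<exists>C :: nat \<Rightarrow> 'a set.
    (\<forall>i\<le>k. primeideal (C i) R) \<and> (\<forall>i<k. C i \<subset> C (Suc i)) \<and> C k = P}"

text \<open>Meaningful for proper ideals only: the infimum is over the empty set if \<open>J\<close> is the whole ring,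
  so properness of \<open>J\<close> has to be assumed separately.\<close>

definition ideal_height :: "('a, 'b) ring_scheme \<Rightarrow> 'a set \<Rightarrow> enat"
  where "ideal_height R J = (INF P\<in>{P. primeideal P R \<and> J \<subseteq> P}. prime_height R P)"


text \<open>The following facts confirm that \<open>mpoly_ring\<close> is a commutative ring.\<close>

lemma finite_submultisets: "finite {a. a \<subseteq># (m :: 'v multiset)}"
proof (induction m)
  case (add x m)
  have "{a. a \<subseteq># add_mset x m} \<subseteq> {a. a \<subseteq># m} \<union> add_mset x ` {a. a \<subseteq># m}"
  proof
    fix a assume "a \<in> {a. a \<subseteq># add_mset x m}"
    hence a: "a \<subseteq># add_mset x m" by simp
    show "a \<in> {a. a \<subseteq># m} \<union> add_mset x ` {a. a \<subseteq># m}"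
    proof (cases "x \<in># a")
      case True
      then obtain b where b: "a = add_mset x b" by (metis multi_member_split)
      with a show ?thesis by auto
    next
      case False
      hence "a \<subseteq># m" using a
        by (metis diff_single_trivial subset_eq_diff_conv union_mset_add_mset_right add.right_neutral)
      thus ?thesis by simp
    qed
  qed
  thus ?case using add by (meson finite_UnI finite_imageI finite_subset)
qed simp

context cring
begin

lemma indexed_mult_carrier_coeff:
  assumes "carrier_coeff P" "carrier_coeff Q" shows "carrier_coeff (indexed_mult P Q)"
  using assms unfolding carrier_coeff_def indexed_mult_def by (auto intro!: finsum_closed)

lemma indexed_mult_comm:
  fixes P Q :: "'c multiset \<Rightarrow> 'a"
  assumes "carrier_coeff P" "carrier_coeff Q" shows "indexed_mult P Q = indexed_mult Q P"
proof
  fix m :: "'c multiset"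
  have bij: "bij_betw (\<lambda>a. m - a) {a. a \<subseteq># m} {a. a \<subseteq># m}"
    by (rule bij_betwI[where g = "\<lambda>a. m - a"]) (auto simp: double_diff subset_mset.diff_diff_right)
  have "(\<Oplus>a\<in>{a. a \<subseteq># m}. Q a \<otimes> P (m - a))
      = (\<Oplus>a\<in>(\<lambda>a. m - a) ` {a. a \<subseteq># m}. Q a \<otimes> P (m - a))"
    using bij by (simp add: bij_betw_def)
  also have "\<dots> = (\<Oplus>a\<in>{a. a \<subseteq># m}. Q (m - a) \<otimes> P (m - (m - a)))"
    by (rule finsum_reindex) (use bij assms in \<open>auto simp: bij_betw_def carrier_coeff_def\<close>)
  also have "\<dots> = (\<Oplus>a\<in>{a. a \<subseteq># m}. P a \<otimes> Q (m - a))"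
    by (rule finsum_cong')
      (use assms in \<open>auto simp: carrier_coeff_def m_comm subset_mset.diff_diff_right\<close>)
  finally show "indexed_mult P Q m = indexed_mult Q P m" by (simp add: indexed_mult_def)
qed

lemma indexed_mult_padd:
  assumes "carrier_coeff P" "carrier_coeff P'" "carrier_coeff Q"
  shows "indexed_mult (indexed_padd P P') Q = indexed_padd (indexed_mult P Q) (indexed_mult P' Q)"
proof
  fix m
  have "(\<Oplus>a\<in>{a. a \<subseteq># m}. (P a \<oplus> P' a) \<otimes> Q (m - a))
      = (\<Oplus>a\<in>{a. a \<subseteq># m}. P a \<otimes> Q (m - a) \<oplus> P' a \<otimes> Q (m - a))"
    by (rule finsum_cong') (use assms in \<open>auto simp: carrier_coeff_def l_distr\<close>)
  also have "\<dots> = (\<Oplus>a\<in>{a. a \<subseteq># m}. P a \<otimes> Q (m - a)) \<oplus> (\<Oplus>a\<in>{a. a \<subseteq># m}. P' a \<otimes> Q (m - a))"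
    by (rule finsum_addf) (use assms in \<open>auto simp: carrier_coeff_def\<close>)
  finally show "indexed_mult (indexed_padd P P') Q m
      = indexed_padd (indexed_mult P Q) (indexed_mult P' Q) m"
    by (simp add: indexed_mult_def indexed_padd_def)
qed

lemma indexed_mult_const:
  assumes "k \<in> carrier R" "carrier_coeff Q"
  shows "indexed_mult (indexed_const k) Q = (\<lambda>m. k \<otimes> Q m)"
proof
  fix m
  have "(\<Oplus>a\<in>{a. a \<subseteq># m}. indexed_const k a \<otimes> Q (m - a))
      = (\<Oplus>a\<in>{a. a \<subseteq># m}. if {#} = a then k \<otimes> Q (m - a) else \<zero>)"
    by (rule finsum_cong') (use assms in \<open>auto simp: carrier_coeff_def indexed_const_def\<close>)
  also have "\<dots> = k \<otimes> Q m"
    using add.finprod_singleton[of "{#}" "{a. a \<subseteq># m}" "\<lambda>a. k \<otimes> Q (m - a)"] assms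
    by (auto simp: carrier_coeff_def finite_submultisets finsum_def)
  finally show "indexed_mult (indexed_const k) Q m = k \<otimes> Q m" by (simp add: indexed_mult_def)
qed

lemma indexed_mult_pmult:
  fixes P Q :: "'c multiset \<Rightarrow> 'a"
  assumes "carrier_coeff P" "carrier_coeff Q"
  shows "indexed_mult (indexed_pmult P i) Q = indexed_pmult (indexed_mult P Q) i"
proof
  fix m :: "'c multiset"
  let ?S = "{a. a \<subseteq># m \<and> i \<in># a}"
  have S: "?S = add_mset i ` {b. b \<subseteq># m - {#i#}}" if i: "i \<in># m"
  proof -
    obtain n where m: "m = add_mset i n" using multi_member_split[OF i] by blast
    show ?thesis
    proof (intro Set.set_eqI iffI)
      fix a assume "a \<in> ?S"
      moreover from this obtain b where "a = add_mset i b" by (blast dest: multi_member_split)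
      ultimately show "a \<in> add_mset i ` {b. b \<subseteq># m - {#i#}}" using m by auto
    qed (auto simp: m)
  qed
  have "(\<Oplus>a\<in>{a. a \<subseteq># m}. indexed_pmult P i a \<otimes> Q (m - a))
      = (\<Oplus>a\<in>?S. P (a - {#i#}) \<otimes> Q (m - a))"
    by (rule add.finprod_mono_neutral_cong_right[folded finsum_def])
      (use assms in \<open>auto simp: carrier_coeff_def indexed_pmult_def finite_submultisets\<close>)
  also have "\<dots> = indexed_pmult (indexed_mult P Q) i m"
  proof (cases "i \<in># m")
    case False
    hence "?S = {}" by (auto dest: mset_subset_eqD)
    thus ?thesis using False by (simp only: finsum_empty) (simp add: indexed_pmult_def)
  next
    case True
    have "(\<Oplus>a\<in>?S. P (a - {#i#}) \<otimes> Q (m - a))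
        = (\<Oplus>b\<in>{b. b \<subseteq># m - {#i#}}. P (add_mset i b - {#i#}) \<otimes> Q (m - add_mset i b))"
      unfolding S[OF True]
      by (rule finsum_reindex) (use assms in \<open>auto simp: carrier_coeff_def inj_on_def\<close>)
    thus ?thesis using True by (simp add: indexed_pmult_def indexed_mult_def)
  qed
  finally show "indexed_mult (indexed_pmult P i) Q m = indexed_pmult (indexed_mult P Q) i m"
    by (simp add: indexed_mult_def)
qed

lemma indexed_pset_coeff: "P \<in> indexed_pset V (carrier R) \<Longrightarrow> carrier_coeff P"
  by (rule indexed_pset_in_carrier[OF subset_refl])

lemma indexed_smult_closed:
  assumes "k \<in> carrier R" "Q \<in> indexed_pset V (carrier R)"
  shows "(\<lambda>m. k \<otimes> Q m) \<in> indexed_pset V (carrier R)"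
  using assms(2)
proof induction
  case (indexed_const l)
  have eq: "(\<lambda>m. k \<otimes> indexed_const l m) = indexed_const (k \<otimes> l)"
    using assms(1) by (auto simp: indexed_const_def)
  show ?case unfolding eq using indexed_const assms(1) by (intro indexed_pset.indexed_const) simp
next
  case (indexed_padd P Q)
  have eq: "(\<lambda>m. k \<otimes> indexed_padd P Q m) = indexed_padd (\<lambda>m. k \<otimes> P m) (\<lambda>m. k \<otimes> Q m)"
    using assms(1) indexed_padd(1,2)[THEN indexed_pset_coeff]
    by (auto simp: indexed_padd_def carrier_coeff_def r_distr)
  show ?case unfolding eq using indexed_padd by (intro indexed_pset.indexed_padd)
next
  case (indexed_pmult P i)
  have eq: "(\<lambda>m. k \<otimes> indexed_pmult P i m) = indexed_pmult (\<lambda>m. k \<otimes> P m) i"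
    using assms(1) by (auto simp: indexed_pmult_def)
  show ?case unfolding eq using indexed_pmult by (intro indexed_pset.indexed_pmult)
qed

lemma indexed_mult_closed:
  assumes "P \<in> indexed_pset V (carrier R)" "Q \<in> indexed_pset V (carrier R)"
  shows "indexed_mult P Q \<in> indexed_pset V (carrier R)"
  using assms(1)
  by induction
    (use assms(2) in \<open>simp_all add: indexed_mult_const indexed_mult_padd indexed_mult_pmult
      indexed_pset_coeff indexed_smult_closed indexed_pset.intros\<close>)

lemma indexed_mult_assoc:
  assumes "P \<in> indexed_pset V (carrier R)" "carrier_coeff Q" "carrier_coeff S"
  shows "indexed_mult (indexed_mult P Q) S = indexed_mult P (indexed_mult Q S)"
  using assms(1)
proof induction
  case (indexed_const k)
  have "indexed_mult (\<lambda>m. k \<otimes> Q m) S = (\<lambda>m. k \<otimes> indexed_mult Q S m)"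
  proof
    fix m
    have "(\<Oplus>a\<in>{a. a \<subseteq># m}. (k \<otimes> Q a) \<otimes> S (m - a))
        = (\<Oplus>a\<in>{a. a \<subseteq># m}. k \<otimes> (Q a \<otimes> S (m - a)))"
      by (rule finsum_cong') (use assms indexed_const in \<open>auto simp: carrier_coeff_def m_assoc\<close>)
    also have "\<dots> = k \<otimes> (\<Oplus>a\<in>{a. a \<subseteq># m}. Q a \<otimes> S (m - a))"
      by (rule finsum_rdistr[symmetric])
        (use assms indexed_const in \<open>auto simp: carrier_coeff_def finite_submultisets\<close>)
    finally show "indexed_mult (\<lambda>m. k \<otimes> Q m) S m = k \<otimes> indexed_mult Q S m"
      by (simp add: indexed_mult_def)
  qed
  thus ?case using assms indexed_const
    by (simp add: indexed_mult_const indexed_mult_carrier_coeff)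
qed (use assms in \<open>simp_all add: indexed_mult_padd indexed_mult_pmult indexed_mult_carrier_coeff
      indexed_pset_coeff\<close>)

lemma indexed_padd_assoc:
  assumes "carrier_coeff P" "carrier_coeff Q" "carrier_coeff S"
  shows "indexed_padd (indexed_padd P Q) S = indexed_padd P (indexed_padd Q S)"
  using assms by (simp add: fun_eq_iff indexed_padd_def carrier_coeff_def a_assoc)

lemma indexed_padd_comm:
  assumes "carrier_coeff P" "carrier_coeff Q"
  shows "indexed_padd P Q = indexed_padd Q P"
  using assms by (simp add: fun_eq_iff indexed_padd_def carrier_coeff_def a_comm)

lemma indexed_mult_one:
  fixes P :: "'c multiset \<Rightarrow> 'a"
  assumes "carrier_coeff P"
  shows "indexed_mult (indexed_const \<one>) P = P" and "indexed_mult P (indexed_const \<one>) = P"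
proof -
  show l: "indexed_mult (indexed_const \<one>) P = P"
    using assms by (simp add: indexed_mult_const carrier_coeff_def)
  have "carrier_coeff (indexed_const \<one> :: 'c multiset \<Rightarrow> 'a)"
    by (simp add: carrier_coeff_def indexed_const_def)
  thus "indexed_mult P (indexed_const \<one>) = P" using l indexed_mult_comm[OF assms] by simp
qed

lemma cring_mpoly_ring: "cring (mpoly_ring V)"
proof (intro cringI abelian_groupI comm_monoidI)
  fix P assume "P \<in> carrier (mpoly_ring V)"
  hence P: "P \<in> indexed_pset V (carrier R)" by (simp add: mpoly_ring_def)
  let ?N = "\<lambda>m. \<ominus> \<one> \<otimes> P m"
  have "?N \<in> indexed_pset V (carrier R)" by (rule indexed_smult_closed[OF _ P]) simp
  moreover have "indexed_padd ?N P = indexed_const \<zero>"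
    using indexed_pset_coeff[OF P]
    by (simp add: fun_eq_iff indexed_padd_def indexed_const_def carrier_coeff_def l_minus l_neg)
  ultimately show "\<exists>y\<in>carrier (mpoly_ring V). y \<oplus>\<^bsub>mpoly_ring V\<^esub> P = \<zero>\<^bsub>mpoly_ring V\<^esub>"
    unfolding mpoly_ring_def by (simp only: ring.simps partial_object.simps monoid.simps) blast
qed (simp_all add: mpoly_ring_def indexed_pset.indexed_const indexed_pset.indexed_padd
      indexed_mult_closed indexed_mult_assoc indexed_mult_padd indexed_padd_zero indexed_mult_one
      indexed_padd_assoc indexed_padd_comm indexed_mult_comm indexed_pset_coeff)

end

end

theory Submission
  imports Defs "HOL-Library.Multiset_Order"
begin

text \<open>
  Write \<open>P\<close> for the polynomial ring and \<open>H\<close> for the ideal \<open>(h)\<close> of \<open>P\<close>.  Minimal primes of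
  \<open>A = P/H\<close> are the primes of \<open>P\<close> minimal over \<open>H\<close>, so it suffices to find one prime \<open>Q\<^sub>0 \<supseteq> H\<close> that
  lies in every prime containing \<open>H\<close> (\<open>irreducible_quotient\<close>).

  Over the fraction field \<open>K\<close> of \<open>R\<close> a polynomial of degree one generates a prime ideal, and
  \<open>Q\<^sub>0 = hK[T] \<inter> P\<close> is the candidate.  No fractions are needed: if \<open>f\<^sub>i \<noteq> 0\<close>, then modulo \<open>h\<close> and up to
  powers of \<open>f\<^sub>i\<close> the variable \<open>T\<^sub>i\<close> can be eliminated (\<open>eliminate_variable\<close>), while no nonzero
  multiple of \<open>h\<close> is free of \<open>T\<^sub>i\<close> (\<open>principal_ideal_meets_other_variables_trivially\<close>).  Hence
  \<open>Q\<^sub>0\<close>, the set of all \<open>g\<close> with \<open>f\<^sub>i\<^sup>k g \<in> H\<close> for some \<open>k\<close>, is prime and is the same set for every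
  \<open>i\<close> with \<open>f\<^sub>i \<noteq> 0\<close>.

  Let \<open>Q\<close> be any prime containing \<open>H\<close>.  If some \<open>f\<^sub>j\<close> lies outside \<open>Q\<close>, then \<open>f\<^sub>j\<^sup>k g \<in> H \<subseteq> Q\<close> gives
  \<open>g \<in> Q\<close> at once.  Otherwise \<open>J \<subseteq> Q \<inter> R\<close>; choose a prime \<open>p \<subseteq> Q \<inter> R\<close> minimal over \<open>J\<close>.  The height
  hypothesis provides a prime \<open>p\<^sub>1\<close> with \<open>0 \<noteq> p\<^sub>1 \<subset> p\<close>, and the claim becomes \<open>Q\<^sub>0 \<subseteq> p[T]\<close>.  This is a form
  of Krull's principal ideal theorem for \<open>h\<close> (\<open>krull_principal_ideal_polynomials\<close>).  Suppose
  \<open>g \<in> Q\<^sub>0\<close> were outside \<open>p[T]\<close>.  Then \<open>g\<close> is a unit in \<open>S\<close>, the localization of \<open>P\<close> at \<open>p[T]\<close>, so a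
  power of every generator of \<open>J\<close> lies in \<open>hS\<close>, and \<open>p\<close> is the only prime of \<open>R\<close> between the
  contraction of \<open>hS\<close> and \<open>p\<close>.  So the local ring of \<open>R\<close> at \<open>p\<close> is Artinian modulo this contraction
  and the symbolic powers \<open>q\<^sub>k = p\<^sub>1\<^sup>(\<^sup>k\<^sup>)\<close> become stationary there
  (\<open>descending_chain_stabilizes\<close>): for some \<open>k\<close>, \<open>q\<^sub>k S \<subseteq> q\<^sub>k\<^sub>+\<^sub>1 S + hS\<close>.  As \<open>h \<notin> p\<^sub>1[T]\<close>, multiplication by \<open>h\<close>
  reflects membership in \<open>q\<^sub>k[T]\<close> (\<open>coeff_ideal_cancel\<close>), whence \<open>q\<^sub>k S = q\<^sub>k\<^sub>+\<^sub>1 S + h q\<^sub>k S\<close>.  Nakayama's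
  lemma yields \<open>q\<^sub>k = q\<^sub>k\<^sub>+\<^sub>1\<close>, and applied once more at \<open>p\<^sub>1\<close> it yields \<open>p\<^sub>1 = 0\<close>, a contradiction.
  Only ideals of \<open>R\<close> have to be finitely generated in this argument.

  Localizations enter only through \<open>saturation p I\<close>, the contraction to the ring of the extension
  of \<open>I\<close> to the local ring at \<open>p\<close>.
\<close>

section \<open>Ideals, saturation and Nakayama's lemma\<close>

text \<open>The contraction to the ring of the extension of \<open>I\<close> to the localization at the complement of \<open>p\<close>.\<close>

definition (in ring) saturation :: "'a set \<Rightarrow> 'a set \<Rightarrow> 'a set"
  where "saturation p I = {x \<in> carrier R. \<exists>s \<in> carrier R - p. s \<otimes> x \<in> I}"

context cring
begin

lemma ideal_closed:
  assumes "ideal I R"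
  shows "I \<subseteq> carrier R" and "\<zero> \<in> I"
    and "\<And>a b. a \<in> I \<Longrightarrow> b \<in> I \<Longrightarrow> a \<oplus> b \<in> I"
    and "\<And>a b. a \<in> I \<Longrightarrow> b \<in> I \<Longrightarrow> a \<ominus> b \<in> I"
    and "\<And>a x. a \<in> I \<Longrightarrow> x \<in> carrier R \<Longrightarrow> x \<otimes> a \<in> I"
    and "\<And>a x. a \<in> I \<Longrightarrow> x \<in> carrier R \<Longrightarrow> a \<otimes> x \<in> I"
    and "\<And>a. a \<in> I \<Longrightarrow> a \<in> carrier R"
proof -
  interpret ideal I R by fact
  show "I \<subseteq> carrier R" "\<zero> \<in> I" 
    and "\<And>a b. a \<in> I \<Longrightarrow> b \<in> I \<Longrightarrow> a \<oplus> b \<in> I"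
    and "\<And>a b. a \<in> I \<Longrightarrow> b \<in> I \<Longrightarrow> a \<ominus> b \<in> I"
    and "\<And>a x. a \<in> I \<Longrightarrow> x \<in> carrier R \<Longrightarrow> x \<otimes> a \<in> I"
    and "\<And>a x. a \<in> I \<Longrightarrow> x \<in> carrier R \<Longrightarrow> a \<otimes> x \<in> I"
    and "\<And>a. a \<in> I \<Longrightarrow> a \<in> carrier R"
    by (auto simp: a_minus_def I_l_closed I_r_closed)
qed

lemma ideal_by_closure:
  assumes "I \<subseteq> carrier R" "\<zero> \<in> I" "\<And>a b. a \<in> I \<Longrightarrow> b \<in> I \<Longrightarrow> a \<oplus> b \<in> I"
    and mult: "\<And>a x. a \<in> I \<Longrightarrow> x \<in> carrier R \<Longrightarrow> x \<otimes> a \<in> I"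
  shows "ideal I R"
proof (rule idealI)
  show "subgroup I (add_monoid R)"
  proof (rule subgroup.intro)
    fix x assume x: "x \<in> I"
    hence "\<ominus> x = (\<ominus> \<one>) \<otimes> x" using assms(1) by (auto simp: l_minus)
    hence "\<ominus> x \<in> I" using mult[OF x] by simp
    thus "inv\<^bsub>add_monoid R\<^esub> x \<in> I" by (simp add: a_inv_def)
  qed (use assms in auto)
qed (use assms in \<open>auto simp: m_comm ring_axioms subset_iff\<close>)

lemma ideal_finsum_closed:
  assumes "ideal I R" and "\<And>a. a \<in> A \<Longrightarrow> g a \<in> I"
  shows "(\<Oplus>a\<in>A. g a) \<in> I"
proof (cases "finite A")
  case True
  thus ?thesis using assms(2)
  proof induction
    case (insert a A)
    hence "(\<Oplus>a\<in>insert a A. g a) = g a \<oplus> (\<Oplus>a\<in>A. g a)"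
      using ideal_closed(7)[OF assms(1)] by (intro finsum_insert) auto
    thus ?case using insert ideal_closed(3)[OF assms(1)] by auto
  qed (simp add: ideal_closed(2)[OF assms(1)])
next
  case False
  thus ?thesis using ideal_closed(2)[OF assms(1)] by (simp add: finsum_def finprod_def)
qed

lemma colon_ideal:
  assumes "ideal I R" "x \<in> carrier R"
  shows "ideal {r \<in> carrier R. r \<otimes> x \<in> I} R"
  by (rule ideal_by_closure)
    (use assms ideal_closed[OF assms(1)] in \<open>auto simp: l_distr m_assoc\<close>)

lemma prime_idealD:
  assumes "primeideal p R"
  shows "ideal p R" and "\<one> \<notin> p"
    and "\<And>a b. a \<in> carrier R - p \<Longrightarrow> b \<in> carrier R - p \<Longrightarrow> a \<otimes> b \<in> carrier R - p"
proof -
  interpret primeideal p R by fact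
  show "ideal p R" by (rule is_ideal)
  show "\<one> \<notin> p" using I_notcarr one_imp_carrier by blast
  show "\<And>a b. a \<in> carrier R - p \<Longrightarrow> b \<in> carrier R - p \<Longrightarrow> a \<otimes> b \<in> carrier R - p"
    using I_prime by auto
qed

lemma set_add_iff: "x \<in> A <+> B \<longleftrightarrow> (\<exists>a\<in>A. \<exists>b\<in>B. x = a \<oplus> b)"
  by (auto simp: set_add_def')

lemma ideal_sum_upper:
  assumes "ideal A R" "ideal B R" shows "A \<subseteq> A <+> B" "B \<subseteq> A <+> B"
proof -
  show "A \<subseteq> A <+> B" 
  proof
    fix a assume "a \<in> A"
    hence "a = a \<oplus> \<zero>" using ideal_closed(7)[OF assms(1)] by simp
    thus "a \<in> A <+> B" using \<open>a \<in> A\<close> ideal_closed(2)[OF assms(2)] by (auto simp: set_add_iff)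
  qed
  show "B \<subseteq> A <+> B" 
  proof
    fix a assume "a \<in> B"
    hence "a = \<zero> \<oplus> a" using ideal_closed(7)[OF assms(2)] by simp
    thus "a \<in> A <+> B" using \<open>a \<in> B\<close> ideal_closed(2)[OF assms(1)] by (auto simp: set_add_iff)
  qed
qed

lemma saturation_ideal:
  assumes "primeideal p R" "ideal I R" shows "ideal (saturation p I) R"
proof (rule ideal_by_closure)
  note I = ideal_closed[OF assms(2)]
  show "\<zero> \<in> saturation p I"
    using I(2) prime_idealD(2)[OF assms(1)] by (auto simp: saturation_def intro!: bexI[of _ \<one>])
  fix a b assume a: "a \<in> saturation p I" 
  then obtain s where s: "s \<in> carrier R - p" "s \<otimes> a \<in> I" "a \<in> carrier R"
    by (auto simp: saturation_def)
  { assume b: "b \<in> saturation p I"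
    then obtain t where t: "t \<in> carrier R - p" "t \<otimes> b \<in> I" "b \<in> carrier R"
      by (auto simp: saturation_def)
    have st: "s \<in> carrier R" "t \<in> carrier R" using s t by auto
    have "(s \<otimes> t) \<otimes> (a \<oplus> b) = t \<otimes> (s \<otimes> a) \<oplus> s \<otimes> (t \<otimes> b)"
      using st s(3) t(3) by algebra
    also have "\<dots> \<in> I" using s t I by auto
    finally show "a \<oplus> b \<in> saturation p I"
      using prime_idealD(3)[OF assms(1) s(1) t(1)] s t by (auto simp: saturation_def)
  }
  fix x assume x: "x \<in> carrier R"
  have "s \<in> carrier R" using s by auto
  hence "s \<otimes> (x \<otimes> a) = x \<otimes> (s \<otimes> a)" using s(3) x by algebra
  also have "\<dots> \<in> I" using s x I by auto
  finally show "x \<otimes> a \<in> saturation p I" using s x by (auto simp: saturation_def)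
qed (auto simp: saturation_def)

lemma saturationI: "s \<in> carrier R \<Longrightarrow> s \<notin> p \<Longrightarrow> x \<in> carrier R \<Longrightarrow> s \<otimes> x \<in> I \<Longrightarrow> x \<in> saturation p I"
  by (auto simp: saturation_def)

lemma saturationE:
  assumes "x \<in> saturation p I"
  obtains s where "s \<in> carrier R" "s \<notin> p" "x \<in> carrier R" "s \<otimes> x \<in> I"
  using assms by (auto simp: saturation_def)

lemma saturation_mono: "I \<subseteq> I' \<Longrightarrow> saturation p I \<subseteq> saturation p I'"
  by (auto simp: saturation_def)

lemma saturation_upper:
  assumes "primeideal p R" "I \<subseteq> carrier R" shows "I \<subseteq> saturation p I"
  using assms prime_idealD(2)[OF assms(1)] by (auto intro!: saturationI[of \<one>])

lemma saturation_closed: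
  assumes "primeideal p R" and s: "s \<in> carrier R" "s \<notin> p" and x: "x \<in> carrier R"
    and "s \<otimes> x \<in> saturation p I"
  shows "x \<in> saturation p I"
proof -
  obtain t where t: "t \<in> carrier R" "t \<notin> p" "t \<otimes> (s \<otimes> x) \<in> I" using assms(5) by (rule saturationE)
  have "(t \<otimes> s) \<otimes> x \<in> I" using t s x by (simp add: m_assoc)
  moreover have "t \<otimes> s \<in> carrier R - p" using prime_idealD(3)[OF assms(1)] s t by blast
  ultimately show ?thesis using x by (auto intro!: saturationI[of "t \<otimes> s"])
qed

lemma prime_saturated:
  assumes "primeideal p R" shows "saturation p p \<subseteq> p"
  using assms prime_idealD(3)[OF assms] by (auto simp: saturation_def)

lemma mult_mem_genideal_products:
  assumes N: "ideal N R" and G: "G \<subseteq> carrier R" and Q: "ideal Q R" and i: "i \<in> Q" and j: "j \<in> Idl G"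
  shows "i \<otimes> j \<in> Idl (N \<union> {c \<otimes> g | c g. c \<in> Q \<and> g \<in> G})"
proof -
  let ?X = "N \<union> {c \<otimes> g | c g. c \<in> Q \<and> g \<in> G}"
  have i': "i \<in> carrier R" using ideal_closed(7)[OF Q i] .
  have X: "?X \<subseteq> carrier R" using ideal_closed(1)[OF N] ideal_closed(1)[OF Q] G by blast
  have "ideal {r \<in> carrier R. r \<otimes> i \<in> Idl ?X} R"
    by (rule colon_ideal[OF genideal_ideal[OF X] i'])
  moreover have "G \<subseteq> {r \<in> carrier R. r \<otimes> i \<in> Idl ?X}"
  proof
    fix g assume g: "g \<in> G"
    hence "i \<otimes> g \<in> Idl ?X" using genideal_self[OF X] i by blast
    thus "g \<in> {r \<in> carrier R. r \<otimes> i \<in> Idl ?X}" using g G i' m_comm[of g i] by auto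
  qed
  ultimately have "Idl G \<subseteq> {r \<in> carrier R. r \<otimes> i \<in> Idl ?X}" by (rule genideal_minimal)
  thus ?thesis using j i' m_comm[of j i] by auto
qed

text \<open>
  Nakayama's lemma in the localization at \<open>Q\<close>, for the module generated by \<open>G\<close> modulo \<open>N\<close>: if every
  generator lies, after localization, in \<open>N + Q\<cdot>(G)\<close>, then the module is zero.  Instead of a determinant,
  one generator \<open>x\<close> is eliminated at a time: in \<open>s x = e + c x\<close> with \<open>c \<in> Q\<close> and \<open>s \<notin> Q\<close> the factor
  \<open>s - c\<close> is outside \<open>Q\<close>, so \<open>x\<close> is a combination of \<open>N\<close> and the other generators, and these satisfy
  the same hypothesis.
\<close>

lemma nakayama_saturation:
  assumes Q: "primeideal Q R" and N: "ideal N R" and "finite G" "G \<subseteq> carrier R"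
    and "G \<subseteq> saturation Q (Idl (N \<union> {c \<otimes> g | c g. c \<in> Q \<and> g \<in> G}))"
  shows "G \<subseteq> saturation Q N"
  using assms(3-5)
proof (induction G)
  case (insert x G)
  note Q' = prime_idealD(1)[OF Q]
  define E where "E = Idl (N \<union> {c \<otimes> g | c g. c \<in> Q \<and> g \<in> G})"
  have x: "x \<in> carrier R" and G: "G \<subseteq> carrier R" using insert by auto
  have X: "N \<union> {c \<otimes> g | c g. c \<in> Q \<and> g \<in> G} \<subseteq> carrier R"
    using ideal_closed(1)[OF N] ideal_closed(1)[OF Q'] G by blast
  have E: "ideal E R" unfolding E_def by (rule genideal_ideal[OF X])
  have Esub: "N \<union> {c \<otimes> g | c g. c \<in> Q \<and> g \<in> G} \<subseteq> E" unfolding E_def by (rule genideal_self[OF X])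
  have Qx: "ideal {c \<otimes> x | c. c \<in> Q} R"
  proof (rule ideal_by_closure)
    show "{c \<otimes> x | c. c \<in> Q} \<subseteq> carrier R" using x ideal_closed(7)[OF Q'] by auto
    have "\<zero> = \<zero> \<otimes> x" using x by simp
    thus "\<zero> \<in> {c \<otimes> x | c. c \<in> Q}" using ideal_closed(2)[OF Q'] by blast
    fix a b assume "a \<in> {c \<otimes> x | c. c \<in> Q}" 
    then obtain c where c: "a = c \<otimes> x" "c \<in> Q" "c \<in> carrier R" using ideal_closed(7)[OF Q'] by auto
    { assume "b \<in> {c \<otimes> x | c. c \<in> Q}"
      then obtain d where d: "b = d \<otimes> x" "d \<in> Q" "d \<in> carrier R" using ideal_closed(7)[OF Q'] by auto
      have "a \<oplus> b = (c \<oplus> d) \<otimes> x" using c d x by (simp add: l_distr)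
      thus "a \<oplus> b \<in> {c \<otimes> x | c. c \<in> Q}" using c d ideal_closed(3)[OF Q'] by blast }
    fix y assume y: "y \<in> carrier R"
    have "y \<otimes> a = (y \<otimes> c) \<otimes> x" using c y x by (simp add: m_assoc)
    thus "y \<otimes> a \<in> {c \<otimes> x | c. c \<in> Q}" using c y ideal_closed(5)[OF Q'] by blast
  qed
  have sub: "Idl (N \<union> {c \<otimes> g | c g. c \<in> Q \<and> g \<in> insert x G}) \<subseteq> E <+> {c \<otimes> x | c. c \<in> Q}"
  proof (rule genideal_minimal[OF add_ideals[OF E Qx]])
    show "N \<union> {c \<otimes> g |c g. c \<in> Q \<and> g \<in> insert x G} \<subseteq> E <+> {c \<otimes> x |c. c \<in> Q}"
      using ideal_sum_upper[OF E Qx] Esub by blast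
  qed
  have split: "\<exists>s e c. s \<in> carrier R \<and> s \<notin> Q \<and> e \<in> E \<and> c \<in> Q \<and> s \<otimes> y = e \<oplus> c \<otimes> x"
    if y: "y \<in> insert x G" for y
  proof -
    obtain s where s: "s \<in> carrier R" "s \<notin> Q"
      "s \<otimes> y \<in> Idl (N \<union> {c \<otimes> g | c g. c \<in> Q \<and> g \<in> insert x G})"
      using insert.prems(2) y by (blast elim: saturationE)
    hence "s \<otimes> y \<in> E <+> {c \<otimes> x | c. c \<in> Q}" using sub by blast
    thus ?thesis using s by (auto simp: set_add_iff)
  qed
  obtain s e c where s: "s \<in> carrier R" "s \<notin> Q" "e \<in> E" "c \<in> Q" "s \<otimes> x = e \<oplus> c \<otimes> x"
    using split[of x] by auto
  have ce: "c \<in> carrier R" "e \<in> carrier R" using s ideal_closed(7)[OF Q'] ideal_closed(7)[OF E] by auto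
  define t where "t = s \<ominus> c"
  have t: "t \<in> carrier R" using s ce by (simp add: t_def)
  have "t \<notin> Q"
  proof
    assume "t \<in> Q"
    hence "t \<oplus> c \<in> Q" using s ideal_closed(3)[OF Q'] by blast
    moreover have "t \<oplus> c = s" unfolding t_def using s(1) ce by algebra
    ultimately show False using s by simp
  qed
  have "t \<otimes> x = s \<otimes> x \<ominus> c \<otimes> x" unfolding t_def using s(1) ce x by algebra
  also have "\<dots> = e" unfolding s(5) using ce x by algebra
  finally have tx: "t \<otimes> x = e" .
  have "G \<subseteq> saturation Q E"
  proof
    fix y assume y: "y \<in> G"
    hence yc: "y \<in> carrier R" using G by auto
    obtain s' e' c' where s': "s' \<in> carrier R" "s' \<notin> Q" "e' \<in> E" "c' \<in> Q" "s' \<otimes> y = e' \<oplus> c' \<otimes> x"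
      using split[of y] y by auto
    have ce': "c' \<in> carrier R" "e' \<in> carrier R" using s' ideal_closed(7)[OF Q'] ideal_closed(7)[OF E] by auto
    have "(t \<otimes> s') \<otimes> y = t \<otimes> (s' \<otimes> y)" using t s' yc by (simp add: m_assoc)
    also have "\<dots> = t \<otimes> e' \<oplus> c' \<otimes> (t \<otimes> x)" unfolding s'(5) using ce' t x by algebra
    also have "\<dots> \<in> E" unfolding tx using s s' t ce' ideal_closed[OF E] by auto
    finally show "y \<in> saturation Q E"
      using prime_idealD(3)[OF Q] t \<open>t \<notin> Q\<close> s' yc by (intro saturationI[of "t \<otimes> s'"]) auto
  qed
  hence IH: "G \<subseteq> saturation Q N" using insert.IH G unfolding E_def by blast
  have sN: "ideal (saturation Q N) R" by (rule saturation_ideal[OF Q N])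
  have "c \<otimes> g \<in> saturation Q N" if "c \<in> Q" "g \<in> G" for c g
    using that IH ideal_closed(5)[OF sN, of g c] ideal_closed(7)[OF Q'] by auto
  hence "N \<union> {c \<otimes> g | c g. c \<in> Q \<and> g \<in> G} \<subseteq> saturation Q N"
    using saturation_upper[OF Q ideal_closed(1)[OF N]] by auto
  hence "E \<subseteq> saturation Q N" unfolding E_def by (rule genideal_minimal[OF sN])
  hence "x \<in> saturation Q N"
    using saturation_closed[OF Q t \<open>t \<notin> Q\<close> x] tx s by blast
  thus ?case using IH by blast
qed simp

text \<open>
  For sums, expand one factor at a time: \<open>(a + b)\<^sup>m a\<^sup>i b\<^sup>j\<close> lies in \<open>I\<close> as soon as \<open>m + i + j \<ge> k + l\<close>, by
  induction on \<open>m\<close>.  This avoids the binomial theorem.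
\<close>

lemma radical_ideal:
  assumes I: "ideal I R" shows "ideal {x \<in> carrier R. \<exists>k::nat. x [^] k \<in> I} R"
proof (rule ideal_by_closure)
  note I' = ideal_closed[OF I]
  have "\<zero> [^] (1::nat) \<in> I" using I' by simp
  thus "\<zero> \<in> {x \<in> carrier R. \<exists>k::nat. x [^] k \<in> I}" by blast
  fix a b assume "a \<in> {x \<in> carrier R. \<exists>k::nat. x [^] k \<in> I}"
  then obtain k :: nat where a: "a \<in> carrier R" "a [^] k \<in> I" by auto
  { assume "b \<in> {x \<in> carrier R. \<exists>k::nat. x [^] k \<in> I}"
    then obtain l :: nat where b: "b \<in> carrier R" "b [^] l \<in> I" by auto
    have "(a \<oplus> b) [^] m \<otimes> (a [^] i \<otimes> b [^] j) \<in> I" if "m + i + j \<ge> k + l" for m i j :: nat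
      using that
    proof (induction m arbitrary: i j)
      case 0
      hence "i \<ge> k \<or> j \<ge> l" by linarith
      thus ?case
      proof
        assume "i \<ge> k"
        hence "a [^] i = a [^] k \<otimes> a [^] (i - k)" using a by (simp add: nat_pow_mult)
        thus ?thesis using a b I' by auto
      next
        assume "j \<ge> l"
        hence "b [^] j = b [^] l \<otimes> b [^] (j - l)" using b by (simp add: nat_pow_mult)
        thus ?thesis using a b I' by auto
      qed
    next
      case (Suc m)
      have "(a \<oplus> b) [^] Suc m \<otimes> (a [^] i \<otimes> b [^] j)
        = ((a \<oplus> b) [^] m \<otimes> (a \<oplus> b)) \<otimes> (a [^] i \<otimes> b [^] j)" by simp
      also have "\<dots> = (a \<oplus> b) [^] m \<otimes> ((a [^] i \<otimes> a) \<otimes> b [^] j) \<oplus> (a \<oplus> b) [^] m \<otimes> (a [^] i \<otimes> (b [^] j \<otimes> b))"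
      proof -
        have "(a \<oplus> b) [^] m \<in> carrier R" "a [^] i \<in> carrier R" "b [^] j \<in> carrier R" using a b by auto
        thus ?thesis using a(1) b(1) by algebra
      qed
      also have "\<dots> = (a \<oplus> b) [^] m \<otimes> (a [^] Suc i \<otimes> b [^] j) \<oplus> (a \<oplus> b) [^] m \<otimes> (a [^] i \<otimes> b [^] Suc j)"
        by simp
      also have "\<dots> \<in> I" using Suc.IH[of "Suc i" j] Suc.IH[of i "Suc j"] Suc.prems I'(3) by simp
      finally show ?case .
    qed
    from this[of "k + l" 0 0] have "(a \<oplus> b) [^] (k + l) \<in> I" using a b by simp
    thus "a \<oplus> b \<in> {x \<in> carrier R. \<exists>k::nat. x [^] k \<in> I}" using a b by auto }
  fix x assume x: "x \<in> carrier R"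
  have "(x \<otimes> a) [^] k = x [^] k \<otimes> a [^] k" using x a by (simp add: nat_pow_distrib)
  hence "(x \<otimes> a) [^] k \<in> I" using x a I' by simp
  thus "x \<otimes> a \<in> {x \<in> carrier R. \<exists>k::nat. x [^] k \<in> I}" using x a by auto
qed auto

end

lemma (in cring) prime_powD:
  assumes "primeideal p R" "x \<in> carrier R" "x [^] (k::nat) \<in> p" shows "x \<in> p"
  using assms(3)
proof (induction k)
  case 0
  thus ?case using prime_idealD(2)[OF assms(1)] by simp
next
  case (Suc k)
  thus ?case using primeideal.I_prime[OF assms(1), of "x [^] k" x] assms(2) by auto
qed

section \<open>Noetherian rings and symbolic powers\<close>

lemma (in noetherian_ring) exists_maximal_ideal_with:
  assumes "Q I" and "\<And>I. Q I \<Longrightarrow> ideal I R"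
  shows "\<exists>M. Q M \<and> (\<forall>I. Q I \<longrightarrow> M \<subseteq> I \<longrightarrow> I = M)"
proof -
  have "\<exists>M\<in>Collect Q. \<forall>I\<in>Collect Q. M \<subseteq> I \<longrightarrow> I = M"
  proof (rule subset_Zorn)
    fix C assume C: "subset.chain (Collect Q) C"
    show "\<exists>U\<in>Collect Q. \<forall>Y\<in>C. Y \<subseteq> U"
    proof (cases "C = {}")
      case False
      have "subset.chain {I. ideal I R} C" using C assms(2) by (auto simp: subset.chain_def)
      hence "\<Union>C \<in> C" by (rule ideal_chain_is_trivial[OF False])
      moreover have "C \<subseteq> Collect Q" using C by (simp add: subset.chain_def)
      ultimately show ?thesis by blast
    qed (use assms(1) in auto)
  qed
  thus ?thesis by simp
qed

context cring
begin

lemma proper_ideal_le_prime: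
  assumes "noetherian_ring R" "ideal J R" "J \<noteq> carrier R"
  shows "\<exists>p. primeideal p R \<and> J \<subseteq> p"
proof -
  interpret noetherian_ring R by fact
  have "\<exists>M. (ideal M R \<and> J \<subseteq> M \<and> M \<noteq> carrier R) \<and>
      (\<forall>I. ideal I R \<and> J \<subseteq> I \<and> I \<noteq> carrier R \<longrightarrow> M \<subseteq> I \<longrightarrow> I = M)"
    by (rule exists_maximal_ideal_with[of "\<lambda>M. ideal M R \<and> J \<subseteq> M \<and> M \<noteq> carrier R" J])
      (use assms(2,3) in simp_all)
  then obtain M where M: "ideal M R \<and> J \<subseteq> M \<and> M \<noteq> carrier R"
    and max: "\<forall>I. ideal I R \<and> J \<subseteq> I \<and> I \<noteq> carrier R \<longrightarrow> M \<subseteq> I \<longrightarrow> I = M"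
    by (elim exE conjE) simp
  have "maximalideal M R"
  proof (rule maximalidealI)
    fix I assume "ideal I R" "M \<subseteq> I" "I \<subseteq> carrier R"
    thus "I = M \<or> I = carrier R" using M max[rule_format, of I] by auto
  qed (use M in auto)
  thus ?thesis using maximalideal_prime M by blast
qed

text \<open>Zorn's lemma downwards: the intersection of a chain of primes is prime.\<close>

lemma exists_minimal_prime_over:
  assumes "primeideal q R" "J \<subseteq> q"
  shows "\<exists>p. primeideal p R \<and> J \<subseteq> p \<and> p \<subseteq> q \<and>
    (\<forall>p'. primeideal p' R \<and> J \<subseteq> p' \<and> p' \<subseteq> p \<longrightarrow> p' = p)"
proof -
  define A where "A = {p. primeideal p R \<and> J \<subseteq> p \<and> p \<subseteq> q}"
  have "\<exists>m\<in>A. \<forall>a\<in>A. m \<supseteq> a \<longrightarrow> a = m"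
  proof (rule predicate_Zorn)
    show "partial_order_on A (relation_of (\<supseteq>) A)"
      by (rule partial_order_on_relation_ofI) auto
    fix C assume "C \<in> Chains (relation_of (\<supseteq>) A)"
    hence CA: "C \<subseteq> A" and chain: "\<And>a b. a \<in> C \<Longrightarrow> b \<in> C \<Longrightarrow> a \<subseteq> b \<or> b \<subseteq> a"
      by (auto simp: Chains_def relation_of_def)
    show "\<exists>u\<in>A. \<forall>a\<in>C. u \<subseteq> a"
    proof (cases "C = {}")
      case True
      thus ?thesis using assms by (auto simp: A_def)
    next
      case False
      have prime: "primeideal c R" if "c \<in> C" for c using CA that by (auto simp: A_def)
      have "primeideal (\<Inter>C) R"
      proof (rule primeidealI)
        show "ideal (\<Inter>C) R" using False prime_idealD(1)[OF prime] by (intro i_Intersect) auto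
        show "cring R" by (rule is_cring)
        show "carrier R \<noteq> \<Inter>C" using False prime_idealD(2)[OF prime] by auto
        fix a b assume ab: "a \<in> carrier R" "b \<in> carrier R" "a \<otimes> b \<in> \<Inter>C"
        show "a \<in> \<Inter>C \<or> b \<in> \<Inter>C"
        proof (rule ccontr)
          assume "\<not> (a \<in> \<Inter>C \<or> b \<in> \<Inter>C)"
          then obtain c d where cd: "c \<in> C" "a \<notin> c" "d \<in> C" "b \<notin> d" by auto
          define e where "e = c \<inter> d"
          have "e = c \<or> e = d" using chain[OF cd(1,3)] unfolding e_def by blast
          hence e: "e \<in> C" using cd(1,3) by metis
          have "a \<notin> e" "b \<notin> e" using cd(2,4) unfolding e_def by blast+
          hence "a \<otimes> b \<notin> e" using prime_idealD(3)[OF prime[OF e], of a b] ab(1,2) by blast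
          thus False using e ab(3) by blast
        qed
      qed
      hence "\<Inter>C \<in> A" using False CA by (auto simp: A_def)
      thus ?thesis by blast
    qed
  qed
  then obtain m where m: "m \<in> A" "\<And>a. a \<in> A \<Longrightarrow> a \<subseteq> m \<Longrightarrow> a = m" by auto
  have "p' = m" if "primeideal p' R" "J \<subseteq> p'" "p' \<subseteq> m" for p'
    using m(1) that by (intro m(2)) (auto simp: A_def)
  thus ?thesis using m(1) by (auto simp: A_def)
qed

text \<open>
  If \<open>p\<close> is minimal over \<open>I\<^sub>0\<close>, then the local ring at \<open>p\<close> is Artinian modulo \<open>I\<^sub>0\<close>, so a descending
  chain becomes stationary there; one stationary step is all that is used later.  The proof is a
  Noetherian induction on \<open>I\<^sub>0\<close> for the stronger claim that stationary steps occur arbitrarily far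
  out.  For a maximal counterexample \<open>M\<close>, an associated prime of \<open>M\<close> inside \<open>p\<close> contains \<open>I\<^sub>0\<close> and is
  therefore \<open>p\<close>; say it is the annihilator of \<open>x\<close> modulo \<open>M\<close>.  The claim holds for \<open>M + (x)\<close>, and
  \<open>(M + (x))/M\<close> has length one at \<open>p\<close>: the chain meets it either in everything or in nothing, and
  from some index on this does not change.
\<close>

lemma descending_chain_stabilizes:
  assumes noeth: "noetherian_ring R" and p: "primeideal p R" and I0: "ideal I0 R"
    and minimal: "\<And>p'. primeideal p' R \<Longrightarrow> I0 \<subseteq> p' \<Longrightarrow> p' \<subseteq> p \<Longrightarrow> p' = p"
    and C: "\<And>k::nat. ideal (C k) R" and desc: "\<And>k. C (Suc k) \<subseteq> C k"
  shows "\<exists>k. C k \<subseteq> saturation p (C (Suc k) <+> I0)"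
proof -
  interpret noetherian_ring R by fact
  define good where "good = (\<lambda>I. \<forall>m. \<exists>k\<ge>m. C k \<subseteq> saturation p (C (Suc k) <+> I))"
  have "good I0"
  proof (rule ccontr)
    assume bad: "\<not> good I0"
    have "\<exists>M. (ideal M R \<and> I0 \<subseteq> M \<and> \<not> good M) \<and>
        (\<forall>I. ideal I R \<and> I0 \<subseteq> I \<and> \<not> good I \<longrightarrow> M \<subseteq> I \<longrightarrow> I = M)"
      by (rule exists_maximal_ideal_with[of "\<lambda>M. ideal M R \<and> I0 \<subseteq> M \<and> \<not> good M" I0])
        (use I0 bad in simp_all)
    then obtain M where M: "ideal M R" "I0 \<subseteq> M" "\<not> good M"
      and max: "\<forall>I. ideal I R \<and> I0 \<subseteq> I \<and> \<not> good I \<longrightarrow> M \<subseteq> I \<longrightarrow> I = M"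
      by (elim exE conjE) simp
    note M' = ideal_closed[OF M(1)]
    define S where "S = saturation p M"
    have S: "ideal S R" unfolding S_def by (rule saturation_ideal[OF p M(1)])
    note S' = ideal_closed[OF S]
    have MS: "M \<subseteq> S" unfolding S_def by (rule saturation_upper[OF p M'(1)])
    have sum: "ideal (C k <+> M) R" for k by (rule add_ideals[OF C M(1)])
    have sat: "ideal (saturation p (C k <+> M)) R" for k by (rule saturation_ideal[OF p sum])
    have S_sum: "S \<subseteq> saturation p (C k <+> M)" for k
      unfolding S_def by (rule saturation_mono[OF ideal_sum_upper(2)[OF C M(1)]])
    have C_sum: "C k \<subseteq> saturation p (C k <+> M)" for k
      using ideal_sum_upper(1)[OF C M(1)] saturation_upper[OF p ideal_closed(1)[OF sum]] by blast
    have one: "\<one> \<notin> S"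
    proof
      assume "\<one> \<in> S"
      hence "S = carrier R" using S'(5)[of \<one>] S'(1) by auto
      hence "C k \<subseteq> saturation p (C (Suc k) <+> M)" for k 
        using S_sum[of "Suc k"] ideal_closed(1)[OF C[of k]] by auto
      thus False using M(3) unfolding good_def by blast
    qed
    \<comment> \<open>A maximal annihilator modulo the saturation of \<open>M\<close> is an associated prime.\<close>
    define D where "D = (\<lambda>x. {r \<in> carrier R. r \<otimes> x \<in> S})"
    have D: "ideal (D x) R" if "x \<in> carrier R" for x 
      unfolding D_def by (rule colon_ideal[OF S that])
    obtain x where x: "x \<in> carrier R" "x \<notin> S" 
      and xmax: "\<And>y. y \<in> carrier R \<Longrightarrow> y \<notin> S \<Longrightarrow> D x \<subseteq> D y \<Longrightarrow> D y = D x"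
    proof -
      have "\<exists>E. (\<exists>x. x \<in> carrier R \<and> x \<notin> S \<and> E = D x) \<and>
          (\<forall>I. (\<exists>x. x \<in> carrier R \<and> x \<notin> S \<and> I = D x) \<longrightarrow> E \<subseteq> I \<longrightarrow> I = E)"
        by (rule exists_maximal_ideal_with[of "\<lambda>E. \<exists>x. x \<in> carrier R \<and> x \<notin> S \<and> E = D x" "D \<one>"])
          (use D one in auto)
      then obtain x where "x \<in> carrier R" "x \<notin> S"
        and "\<forall>I. (\<exists>x. x \<in> carrier R \<and> x \<notin> S \<and> I = D x) \<longrightarrow> D x \<subseteq> I \<longrightarrow> I = D x"
        by (elim exE conjE) simp
      thus ?thesis by (intro that[of x]) blast+
    qed
    have "primeideal (D x) R"
    proof (rule primeidealI[OF D[OF x(1)] is_cring])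
      have "\<one> \<notin> D x" using x by (simp add: D_def)
      thus "carrier R \<noteq> D x" by auto
      fix a b assume ab: "a \<in> carrier R" "b \<in> carrier R" "a \<otimes> b \<in> D x"
      show "a \<in> D x \<or> b \<in> D x"
      proof (rule disjCI)
        assume b: "b \<notin> D x"
        have "r \<otimes> (b \<otimes> x) \<in> S" if "r \<in> carrier R" "r \<otimes> x \<in> S" for r
        proof -
          have "r \<otimes> (b \<otimes> x) = b \<otimes> (r \<otimes> x)" using that(1) ab x(1) by algebra
          thus ?thesis using S'(5)[OF that(2) ab(2)] by simp
        qed
        hence "D x \<subseteq> D (b \<otimes> x)" by (auto simp: D_def)
        hence "D (b \<otimes> x) = D x" using xmax[of "b \<otimes> x"] ab x b by (auto simp: D_def)
        moreover have "a \<in> D (b \<otimes> x)" using ab x by (simp add: D_def m_assoc)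
        ultimately show "a \<in> D x" by simp
      qed
    qed
    moreover have "I0 \<subseteq> D x"
      using M(2) M' MS S'(6) x(1) by (auto simp: D_def)
    moreover have "D x \<subseteq> p"
      using saturation_closed[OF p _ _ x(1), of _ M] x by (auto simp: D_def S_def)
    ultimately have Dp: "D x = p" by (rule minimal)
    define M2 :: "'a set" where "M2 = M <+> PIdl x"
    have M2: "ideal M2 R" unfolding M2_def by (rule add_ideals[OF M(1) cgenideal_ideal[OF x(1)]])
    have "M \<subseteq> M2" "x \<in> M2"
      using ideal_sum_upper[OF M(1) cgenideal_ideal[OF x(1)]] cgenideal_self[OF x(1)]
      by (auto simp: M2_def)
    hence "good M2" using max[rule_format, of M2] M2 M(2) x MS by blast
    have "good M" unfolding good_def
    proof
      fix m
      \<comment> \<open>Whether the \<open>k\<close>-th ideal of the chain reaches \<open>x\<close> modulo \<open>M\<close>, locally at \<open>p\<close>.\<close>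
      define T where "T = (\<lambda>k. x \<in> saturation p (C k <+> M))"
      have Tanti: "T (Suc k) \<Longrightarrow> T k" for k
      proof -
        have "set_add R (C (Suc k)) M \<subseteq> set_add R (C k) M" using desc[of k] by (auto simp: set_add_iff subset_iff)
        thus "T (Suc k) \<Longrightarrow> T k" unfolding T_def using saturation_mono by blast
      qed
      have Tanti': "\<not> T k \<Longrightarrow> \<not> T l" if "l \<ge> k" for k l
        using that by (induction rule: dec_induct) (use Tanti in blast)+
      obtain k0 where k0: "k0 \<ge> m" "\<And>k. k \<ge> k0 \<Longrightarrow> T k \<Longrightarrow> T (Suc k)"
      proof (cases "\<exists>k\<ge>m. \<not> T k")
        case True
        thus ?thesis using that Tanti' by blast
      next
        case False
        thus ?thesis using that[of m] by auto
      qed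
      obtain k where k: "k \<ge> k0" "C k \<subseteq> saturation p (C (Suc k) <+> M2)"
        using \<open>good M2\<close> unfolding good_def by blast
      have "C k \<subseteq> saturation p (C (Suc k) <+> M)"
      proof
        fix y assume y: "y \<in> C k"
        hence yc: "y \<in> carrier R" using ideal_closed(7)[OF C] by blast
        obtain s where s: "s \<in> carrier R" "s \<notin> p" "s \<otimes> y \<in> C (Suc k) <+> M2"
          using k(2) y by (blast elim: saturationE)
        then obtain z i r where z: "z \<in> C (Suc k)" "i \<in> M" "r \<in> carrier R"
          "s \<otimes> y = z \<oplus> (i \<oplus> r \<otimes> x)"
          by (auto simp: set_add_iff M2_def cgenideal_def)
        have zc: "z \<in> carrier R" "i \<in> carrier R" 
          using z ideal_closed(7)[OF C] M'(7) by blast+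
        let ?U = "saturation p (C (Suc k) <+> M)"
        have rx: "r \<otimes> x \<in> ?U"
        \<comment> \<open>Either \<open>r x\<close> already vanishes modulo \<open>M\<close>, or \<open>x\<close> is reached at step \<open>k\<close> and hence at \<open>k + 1\<close>.\<close>
        proof (cases "r \<in> p")
          case True
          hence "r \<otimes> x \<in> S" using Dp by (auto simp: D_def)
          thus ?thesis using S_sum by blast
        next
          case False
          have "r \<otimes> x = s \<otimes> y \<ominus> z \<ominus> i" unfolding z(4) using z(3) zc x(1) by algebra
          also have "\<dots> \<in> saturation p (C k <+> M)"
          proof -
            have "s \<otimes> y \<in> saturation p (C k <+> M)" "z \<in> saturation p (C k <+> M)"
              "i \<in> saturation p (C k <+> M)"
              using C_sum[of k] ideal_closed(5)[OF C y s(1)] desc[of k] z(1) z(2) MS S_sum[of k]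
              by blast+
            thus ?thesis using ideal_closed(4)[OF sat] by blast
          qed
          finally have "T k" unfolding T_def using saturation_closed[OF p z(3) False x(1)] by blast
          hence "x \<in> ?U" using k0(2)[OF k(1)] by (simp add: T_def)
          thus ?thesis using ideal_closed(5)[OF sat _ z(3)] by blast
        qed
        have "z \<in> ?U" "i \<in> ?U" using C_sum[of "Suc k"] z(1,2) MS S_sum[of "Suc k"] by blast+
        hence "s \<otimes> y \<in> ?U" unfolding z(4) using rx ideal_closed(3)[OF sat] by blast
        thus "y \<in> ?U" by (rule saturation_closed[OF p s(1,2) yc])
      qed
      thus "\<exists>k\<ge>m. C k \<subseteq> saturation p (C (Suc k) <+> M)" using k(1) k0(1) by (blast intro: order_trans)
    qed
    thus False using M(3) by blast
  qed
  thus ?thesis unfolding good_def by blast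
qed

end

text \<open>
  The usual symbolic powers: the recursion saturates after each multiplication by \<open>p\<close> instead of
  once at the end, which gives the same ideals for a prime \<open>p\<close>.
\<close>

fun (in ring) symbolic_power :: "'a set \<Rightarrow> nat \<Rightarrow> 'a set"
  where "symbolic_power p 0 = carrier R"
  | "symbolic_power p (Suc k) = saturation p (p \<cdot> symbolic_power p k)"

context cring
begin

lemma symbolic_power_ideal:
  assumes "primeideal p R" shows "ideal (symbolic_power p k) R"
  by (induction k)
    (auto simp: oneideal intro!: saturation_ideal assms ideal_prod_is_ideal prime_idealD(1)[OF assms])

lemma symbolic_power_mult:
  assumes "primeideal p R" "a \<in> p" "b \<in> symbolic_power p k"
  shows "a \<otimes> b \<in> symbolic_power p (Suc k)"
proof -
  have "a \<otimes> b \<in> p \<cdot> symbolic_power p k" using assms by (intro ideal_prod.prod)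
  thus ?thesis
    using saturation_upper[OF assms(1) ideal_prod_in_carrier[OF prime_idealD(1)[OF assms(1)]
        symbolic_power_ideal[OF assms(1)]]] by auto
qed

lemma symbolic_power_saturated:
  assumes "primeideal p R" shows "saturation p (symbolic_power p k) \<subseteq> symbolic_power p k"
proof (cases k)
  case 0
  thus ?thesis by (auto simp: saturation_def)
next
  case (Suc j)
  show ?thesis
  proof
    fix x assume "x \<in> saturation p (symbolic_power p k)"
    then obtain s where "s \<in> carrier R" "s \<notin> p" "x \<in> carrier R" "s \<otimes> x \<in> symbolic_power p k"
      by (rule saturationE)
    thus "x \<in> symbolic_power p k" 
      unfolding Suc symbolic_power.simps by (rule saturation_closed[OF assms])
  qed
qed

lemma symbolic_power_Suc_subset:
  assumes p: "primeideal p R" shows "symbolic_power p (Suc k) \<subseteq> symbolic_power p k"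
proof -
  have "p \<cdot> symbolic_power p k \<subseteq> symbolic_power p k"
    using ideal_prod_inter[OF prime_idealD(1)[OF p] symbolic_power_ideal[OF p]] by blast
  from saturation_mono[OF this, of p] show ?thesis
    using symbolic_power_saturated[OF p, of k] by simp
qed

end

lemma (in domain) nat_pow_nonzero:
  assumes "b \<in> carrier R" "b \<noteq> \<zero>" shows "b [^] (k::nat) \<noteq> \<zero>"
  using assms by (induction k) (auto simp: integral_iff)

text \<open>
  If \<open>q = p\<^sup>(\<^sup>k\<^sup>)\<close> does not shrink, then \<open>q = p q\<close> in the local ring at \<open>p\<close>, so \<open>q = 0\<close> by Nakayama's lemma;
  but \<open>q\<close> contains \<open>b\<^sup>k\<close> for every \<open>b \<in> p\<close>.
\<close>

lemma (in noetherian_domain) symbolic_power_stationary_imp_zero: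
  assumes p: "primeideal p R" and "symbolic_power p k \<subseteq> symbolic_power p (Suc k)"
  shows "p = {\<zero>}"
proof -
  note q = symbolic_power_ideal[OF p, of k]
  obtain G where G: "G \<subseteq> carrier R" "finite G" "symbolic_power p k = Idl G"
    using finetely_gen[OF q] by blast
  let ?E = "Idl ({\<zero>} \<union> {c \<otimes> g | c g. c \<in> p \<and> g \<in> G})"
  have X: "{\<zero>} \<union> {c \<otimes> g | c g. c \<in> p \<and> g \<in> G} \<subseteq> carrier R"
    using G(1) ideal_closed(1)[OF prime_idealD(1)[OF p]] by auto
  have "p \<cdot> (Idl G) \<subseteq> ?E"
  proof
    fix s assume "s \<in> p \<cdot> (Idl G)"
    thus "s \<in> ?E"
    proof induction
      case (prod i j)
      thus ?case using mult_mem_genideal_products[OF zeroideal G(1) prime_idealD(1)[OF p]] by blast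
    next
      case (sum s t)
      thus ?case using ideal_closed(3)[OF genideal_ideal[OF X]] by blast
    qed
  qed
  hence "symbolic_power p k \<subseteq> saturation p ?E"
    using assms(2) saturation_mono[of "p \<cdot> (Idl G)" ?E p] G(3) by auto
  hence "G \<subseteq> saturation p ?E" using G(3) genideal_self[OF G(1)] by blast
  hence "G \<subseteq> saturation p {\<zero>}" by (rule nakayama_saturation[OF p zeroideal G(2,1)])
  also have "\<dots> \<subseteq> {\<zero>}"
    using ideal_closed(2)[OF prime_idealD(1)[OF p]] by (auto simp: saturation_def integral_iff)
  finally have "symbolic_power p k \<subseteq> {\<zero>}" unfolding G(3) by (rule genideal_minimal[OF zeroideal])
  moreover have "b [^] k \<in> symbolic_power p k" if "b \<in> p" for b
  proof (induction k)
    case (Suc k)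
    have "b \<in> carrier R" using that ideal_closed(7)[OF prime_idealD(1)[OF p]] by blast
    thus ?case using symbolic_power_mult[OF p that Suc.IH] by (simp add: m_comm)
  qed simp
  ultimately have "b = \<zero>" if "b \<in> p" for b
    using that nat_pow_nonzero[of b k] ideal_closed(7)[OF prime_idealD(1)[OF p]] by blast
  thus ?thesis using ideal_closed(2)[OF prime_idealD(1)[OF p]] by blast
qed

lemma (in cring) symbolic_power_antimono:
  assumes "primeideal p R" "j \<le> k" shows "symbolic_power p k \<subseteq> symbolic_power p j"
  by (rule lift_Suc_antimono_le[where f = "symbolic_power p", OF symbolic_power_Suc_subset[OF assms(1)] assms(2)])

section \<open>Polynomials with coefficients in an ideal\<close>

definition (in ring) indexed_monom :: "'a \<Rightarrow> 'v multiset \<Rightarrow> ('v multiset \<Rightarrow> 'a)"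
  where "indexed_monom c m = (\<lambda>m'. if m' = m then c else \<zero>)"

text \<open>The extension \<open>I[T]\<close> of an ideal \<open>I\<close> to the polynomial ring.\<close>

definition (in ring) coeff_ideal :: "'v set \<Rightarrow> 'a set \<Rightarrow> ('v multiset \<Rightarrow> 'a) set"
  where "coeff_ideal V I = {P \<in> carrier (mpoly_ring V). \<forall>m. P m \<in> I}"

context cring
begin

lemma mpoly_ring_simps:
  "carrier (mpoly_ring V) = indexed_pset V (carrier R)"
  "P \<otimes>\<^bsub>mpoly_ring V\<^esub> Q = indexed_mult P Q"
  "P \<oplus>\<^bsub>mpoly_ring V\<^esub> Q = indexed_padd P Q"
  "\<one>\<^bsub>mpoly_ring V\<^esub> = indexed_const \<one>"
  "\<zero>\<^bsub>mpoly_ring V\<^esub> = indexed_const \<zero>"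
  by (simp_all add: mpoly_ring_def)

lemma mpoly_coeff_closed: "P \<in> carrier (mpoly_ring V) \<Longrightarrow> P m \<in> carrier R"
  using indexed_pset_coeff[of P V] by (simp add: mpoly_ring_simps carrier_coeff_def)

lemma mpoly_finite_support:
  assumes "P \<in> carrier (mpoly_ring V)" shows "finite {m. P m \<noteq> \<zero>}"
  using assms unfolding mpoly_ring_simps
proof induction
  case (indexed_const k)
  have "{m. indexed_const k m \<noteq> \<zero>} \<subseteq> {{#}}" by (auto simp: indexed_const_def)
  thus ?case by (rule finite_subset) simp
next
  case (indexed_padd P Q)
  have "{m. indexed_padd P Q m \<noteq> \<zero>} \<subseteq> {m. P m \<noteq> \<zero>} \<union> {m. Q m \<noteq> \<zero>}"
    by (auto simp: indexed_padd_def)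
  thus ?case using indexed_padd.IH by (meson finite_UnI finite_subset)
next
  case (indexed_pmult P i)
  have "{m. indexed_pmult P i m \<noteq> \<zero>} \<subseteq> add_mset i ` {m. P m \<noteq> \<zero>}"
  proof
    fix m assume "m \<in> {m. indexed_pmult P i m \<noteq> \<zero>}"
    hence "m = add_mset i (m - {#i#})" "P (m - {#i#}) \<noteq> \<zero>"
      by (auto simp: indexed_pmult_def split: if_splits)
    thus "m \<in> add_mset i ` {m. P m \<noteq> \<zero>}" by blast
  qed
  thus ?case using indexed_pmult.IH by (meson finite_imageI finite_subset)
qed

lemma mpoly_support_vars:
  assumes "P \<in> carrier (mpoly_ring V)" "P m \<noteq> \<zero>" shows "set_mset m \<subseteq> V"
  using assms unfolding mpoly_ring_simps
proof (induction arbitrary: m)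
  case (indexed_const k)
  thus ?case by (auto simp: indexed_const_def split: if_splits)
next
  case (indexed_padd P Q)
  hence "P m \<noteq> \<zero> \<or> Q m \<noteq> \<zero>" by (auto simp: indexed_padd_def)
  thus ?case using indexed_padd.IH by blast
next
  case (indexed_pmult P i)
  hence m: "i \<in># m" "P (m - {#i#}) \<noteq> \<zero>" by (auto simp: indexed_pmult_def split: if_splits)
  have "set_mset m = insert i (set_mset (m - {#i#}))"
    using m(1) by (metis insert_DiffM set_mset_add_mset_insert)
  thus ?case using indexed_pmult.IH[OF m(2)] indexed_pmult.hyps(2) by simp
qed

lemma mpoly_mono_vars:
  assumes "W \<subseteq> V" "P \<in> carrier (mpoly_ring W)" shows "P \<in> carrier (mpoly_ring V)"
  using assms(2) unfolding mpoly_ring_simps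
  by induction (use assms(1) in \<open>auto intro: indexed_pset.intros\<close>)

lemma indexed_var_closed: "i \<in> V \<Longrightarrow> indexed_var i \<in> carrier (mpoly_ring V)"
  by (auto simp: mpoly_ring_simps indexed_var_def intro: indexed_pset.intros)

lemma indexed_const_closed: "k \<in> carrier R \<Longrightarrow> indexed_const k \<in> carrier (mpoly_ring V)"
  by (auto simp: mpoly_ring_simps intro: indexed_pset.intros)

lemma indexed_pmult_eq_var_mult:
  assumes "P \<in> carrier (mpoly_ring V)"
  shows "indexed_pmult P i = indexed_mult (indexed_var i) P"
proof -
  have P: "carrier_coeff P" using assms by (simp add: mpoly_ring_simps indexed_pset_coeff)
  have "carrier_coeff (indexed_const \<one>)" by (simp add: carrier_coeff_def indexed_const_def)
  hence "indexed_mult (indexed_var i) P = indexed_pmult (indexed_mult (indexed_const \<one>) P) i"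
    unfolding indexed_var_def by (rule indexed_mult_pmult[OF _ P])
  thus ?thesis by (simp add: indexed_mult_one[OF P])
qed

lemma indexed_const_hom: "indexed_const \<in> ring_hom R (mpoly_ring V)"
proof (rule ring_hom_memI)
  fix x y assume x: "x \<in> carrier R" and y: "y \<in> carrier R"
  show "indexed_const x \<in> carrier (mpoly_ring V)" using x by (rule indexed_const_closed)
  show "indexed_const (x \<otimes> y) = indexed_const x \<otimes>\<^bsub>mpoly_ring V\<^esub> indexed_const y"
    unfolding mpoly_ring_simps
    by (subst indexed_mult_const) (use x y in \<open>auto simp: carrier_coeff_def indexed_const_def\<close>)
  show "indexed_const (x \<oplus> y) = indexed_const x \<oplus>\<^bsub>mpoly_ring V\<^esub> indexed_const y"
    by (simp add: mpoly_ring_simps indexed_padd_const)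
qed (simp add: mpoly_ring_simps)

lemma indexed_const_hom_ring: "ring_hom_ring R (mpoly_ring V) indexed_const"
  using cring.axioms(1)[OF cring_mpoly_ring] indexed_const_hom
  by (intro ring_hom_ringI2) (simp_all add: ring_axioms)

lemma coeff_ideal_ideal:
  assumes I: "ideal I R" shows "ideal (coeff_ideal V I) (mpoly_ring V)"
proof -
  interpret P: cring "mpoly_ring V" by (rule cring_mpoly_ring)
  note I' = ideal_closed[OF I]
  show ?thesis
  proof (rule P.ideal_by_closure)
    show "\<zero>\<^bsub>mpoly_ring V\<^esub> \<in> coeff_ideal V I"
      unfolding coeff_ideal_def using P.zero_closed I'(2)
      by (auto simp: mpoly_ring_simps indexed_const_def)
    fix a b assume a: "a \<in> coeff_ideal V I"
    { assume b: "b \<in> coeff_ideal V I"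
      have "(a \<oplus>\<^bsub>mpoly_ring V\<^esub> b) m \<in> I" for m
        using a b I'(3) by (simp add: coeff_ideal_def mpoly_ring_simps(3) indexed_padd_def)
      thus "a \<oplus>\<^bsub>mpoly_ring V\<^esub> b \<in> coeff_ideal V I"
        using a b P.add.m_closed by (simp add: coeff_ideal_def) }
    fix x assume x: "x \<in> carrier (mpoly_ring V)"
    have "(x \<otimes>\<^bsub>mpoly_ring V\<^esub> a) m \<in> I" for m
      unfolding mpoly_ring_simps(2) indexed_mult_def
      using a mpoly_coeff_closed[OF x] I'(5)
      by (intro ideal_finsum_closed[OF I]) (auto simp: coeff_ideal_def)
    thus "x \<otimes>\<^bsub>mpoly_ring V\<^esub> a \<in> coeff_ideal V I"
      using a x P.m_closed by (simp add: coeff_ideal_def)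
  qed (auto simp: coeff_ideal_def)
qed

lemma coeff_ideal_const_iff:
  assumes "ideal I R" "c \<in> carrier R"
  shows "indexed_const c \<in> coeff_ideal V I \<longleftrightarrow> c \<in> I"
  using indexed_const_closed[OF assms(2)] ideal_closed(2)[OF assms(1)]
  by (auto simp: coeff_ideal_def indexed_const_def)

lemma coeff_ideal_mono: "I \<subseteq> I' \<Longrightarrow> coeff_ideal V I \<subseteq> coeff_ideal V I'"
  by (auto simp: coeff_ideal_def)

lemma indexed_monom_mem:
  assumes K: "ideal K (mpoly_ring V)" and c: "indexed_const c \<in> K" and m: "set_mset m \<subseteq> V"
  shows "indexed_monom c m \<in> K"
proof -
  interpret P: cring "mpoly_ring V" by (rule cring_mpoly_ring)
  show ?thesis using m
  proof (induction m)
    case empty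
    show ?case using c by (simp add: indexed_monom_def indexed_const_def)
  next
    case (add i m)
    hence IH: "indexed_monom c m \<in> K" and i: "i \<in> V" by auto
    have "indexed_monom c (add_mset i m) = indexed_pmult (indexed_monom c m) i"
      by (auto simp: indexed_monom_def indexed_pmult_def fun_eq_iff dest: multi_member_split)
    also have "\<dots> = indexed_var i \<otimes>\<^bsub>mpoly_ring V\<^esub> indexed_monom c m"
      using indexed_pmult_eq_var_mult[OF P.ideal_closed(7)[OF K IH]] by (simp add: mpoly_ring_simps)
    also have "\<dots> \<in> K" using P.ideal_closed(5)[OF K IH indexed_var_closed[OF i]] .
    finally show ?case .
  qed
qed

text \<open>
  The ideal \<open>I[T]\<close> is generated by the constants in \<open>I\<close>: a polynomial is the finite sum of its terms,
  and each term is a monomial times a constant.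
\<close>

lemma coeff_ideal_subset:
  assumes K: "ideal K (mpoly_ring V)" and const: "\<And>c. c \<in> I \<Longrightarrow> indexed_const c \<in> K"
  shows "coeff_ideal V I \<subseteq> K"
proof
  interpret P: cring "mpoly_ring V" by (rule cring_mpoly_ring)
  fix w assume "w \<in> coeff_ideal V I"
  hence w: "w \<in> carrier (mpoly_ring V)" "\<And>m. w m \<in> I" by (auto simp: coeff_ideal_def)
  have "(\<lambda>m. if m \<in> S then w m else \<zero>) \<in> K" if "finite S" "S \<subseteq> {m. w m \<noteq> \<zero>}" for S
    using that
  proof (induction S)
    case empty
    have "(\<lambda>_. \<zero>) = \<zero>\<^bsub>mpoly_ring V\<^esub>" by (simp add: mpoly_ring_simps indexed_const_def)
    thus ?case using P.ideal_closed(2)[OF K] by simp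
  next
    case (insert m S)
    have eq: "(\<lambda>m'. if m' \<in> insert m S then w m' else \<zero>)
        = (\<lambda>m. if m \<in> S then w m else \<zero>) \<oplus>\<^bsub>mpoly_ring V\<^esub> indexed_monom (w m) m"
      using insert.hyps mpoly_coeff_closed[OF w(1)]
      by (auto simp: mpoly_ring_simps indexed_padd_def indexed_monom_def fun_eq_iff)
    have "set_mset m \<subseteq> V" using mpoly_support_vars[OF w(1), of m] insert.prems by auto
    hence "indexed_monom (w m) m \<in> K" by (rule indexed_monom_mem[OF K const[OF w(2)]])
    thus ?case unfolding eq using insert P.ideal_closed(3)[OF K] by auto
  qed
  from this[OF mpoly_finite_support[OF w(1)] subset_refl]
  have "(\<lambda>m. if m \<in> {m. w m \<noteq> \<zero>} then w m else \<zero>) \<in> K" .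
  moreover have "(\<lambda>m. if m \<in> {m. w m \<noteq> \<zero>} then w m else \<zero>) = w" by auto
  ultimately show "w \<in> K" by simp
qed

text \<open>
  A polynomial \<open>h\<close> outside \<open>p[T]\<close> is a nonzerodivisor on \<open>I[T]/I'[T]\<close> whenever \<open>I/I'\<close> is a torsion-free
  module over the domain \<open>R/p\<close>.  This is Gauss's argument: take the largest monomial \<open>m\<close> whose
  coefficient in \<open>h\<close> is outside \<open>p\<close> and the largest \<open>m'\<close> whose coefficient in \<open>w\<close> is outside \<open>I'\<close>; at
  \<open>m + m'\<close> all products but one lie in \<open>I'\<close>.  The multiset order on monomials is total and
  compatible with addition.  The cases used are \<open>I/I' = R/p\<close> (primality of \<open>p[T]\<close>) and quotients of
  consecutive symbolic powers.
\<close>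

lemma coeff_ideal_cancel:
  fixes V :: "'v::linorder set"
  assumes p: "primeideal p R" and I: "ideal I R" and I': "ideal I' R"
    and pI: "\<And>a b. a \<in> p \<Longrightarrow> b \<in> I \<Longrightarrow> a \<otimes> b \<in> I'"
    and sat: "saturation p I' \<subseteq> I'"
    and h: "h \<in> carrier (mpoly_ring V)" "h \<notin> coeff_ideal V p"
    and w: "w \<in> coeff_ideal V I" and hw: "h \<otimes>\<^bsub>mpoly_ring V\<^esub> w \<in> coeff_ideal V I'"
  shows "w \<in> coeff_ideal V I'"
proof (rule ccontr)
  assume nw: "w \<notin> coeff_ideal V I'"
  have hc: "h m \<in> carrier R" for m by (rule mpoly_coeff_closed[OF h(1)])
  have w': "w \<in> carrier (mpoly_ring V)" and wI: "w m \<in> I" for m using w by (auto simp: coeff_ideal_def)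
  have wc: "w m \<in> carrier R" for m by (rule mpoly_coeff_closed[OF w'])
  define A where "A = {m. h m \<notin> p}"
  define B where "B = {m. w m \<notin> I'}"
  have "A \<subseteq> {m. h m \<noteq> \<zero>}" using ideal_closed(2)[OF prime_idealD(1)[OF p]] by (auto simp: A_def)
  hence A: "finite A" by (rule finite_subset[OF _ mpoly_finite_support[OF h(1)]])
  have "B \<subseteq> {m. w m \<noteq> \<zero>}" using ideal_closed(2)[OF I'] by (auto simp: B_def)
  hence B: "finite B" by (rule finite_subset[OF _ mpoly_finite_support[OF w']])
  have AB: "A \<noteq> {}" "B \<noteq> {}" using h nw w' by (auto simp: A_def B_def coeff_ideal_def)
  define m where "m = Max A"
  define m' where "m' = Max B"
  have mA: "h m \<notin> p" using Max_in[OF A AB(1)] by (simp add: m_def A_def)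
  have mB: "w m' \<notin> I'" using Max_in[OF B AB(2)] by (simp add: m'_def B_def)
  have gtA: "h a \<in> p" if "a > m" for a
    using Max_ge[OF A, of a] leD[of a m] that unfolding m_def A_def by blast
  have gtB: "w b \<in> I'" if "b > m'" for b
    using Max_ge[OF B, of b] leD[of b m'] that unfolding m'_def B_def by blast
  let ?S = "{a. a \<subseteq># m + m'}"
  let ?t = "\<lambda>a. h a \<otimes> w (m + m' - a)"
  have rest: "?t a \<in> I'" if a: "a \<in> ?S - {m}" for a
  proof (cases "a > m")
    case True
    thus ?thesis using gtA pI wI by blast
  next
    case False
    hence lt: "a < m" using a by auto
    have sum: "a + (m + m' - a) = m + m'" using a by (simp add: subset_mset.add_diff_inverse)
    have "m' < m + m' - a"
    proof (rule ccontr)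
      assume "\<not> m' < m + m' - a"
      hence "m + m' - a \<le> m'" by simp
      hence "a + (m + m' - a) < m + m'" using lt by (rule add_less_le_mono[rotated])
      thus False using sum by simp
    qed
    thus ?thesis using gtB ideal_closed(5)[OF I' _ hc] by blast
  qed
  have "indexed_mult h w (m + m') \<in> I'"
    using hw by (simp add: coeff_ideal_def mpoly_ring_simps)
  also have "indexed_mult h w (m + m') = (\<Oplus>a\<in>insert m (?S - {m}). ?t a)"
    unfolding indexed_mult_def by (rule arg_cong[where f = "\<lambda>S. finsum R ?t S"]) auto
  also have "\<dots> = ?t m \<oplus> (\<Oplus>a\<in>?S - {m}. ?t a)"
    by (rule finsum_insert) (use hc wc finite_submultisets in auto)
  finally have total: "?t m \<oplus> (\<Oplus>a\<in>?S - {m}. ?t a) \<in> I'" .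
  have r: "(\<Oplus>a\<in>?S - {m}. ?t a) \<in> I'" by (rule ideal_finsum_closed[OF I' rest])
  have "x = x \<oplus> y \<ominus> y" if "x \<in> carrier R" "y \<in> carrier R" for x y using that by algebra
  from this[of "?t m", OF m_closed[OF hc wc] ideal_closed(7)[OF I' r]]
  have "?t m = ?t m \<oplus> (\<Oplus>a\<in>?S - {m}. ?t a) \<ominus> (\<Oplus>a\<in>?S - {m}. ?t a)" .
  also have "\<dots> \<in> I'" by (rule ideal_closed(4)[OF I' total r])
  finally have "h m \<otimes> w m' \<in> I'" by simp
  hence "w m' \<in> saturation p I'" using hc[of m] mA wc by (auto intro: saturationI)
  thus False using sat mB by blast
qed

lemma coeff_ideal_prime:
  fixes V :: "'v::linorder set"
  assumes p: "primeideal p R" shows "primeideal (coeff_ideal V p) (mpoly_ring V)"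
proof (rule primeidealI[OF coeff_ideal_ideal[OF prime_idealD(1)[OF p]] cring_mpoly_ring])
  note p' = prime_idealD(1)[OF p]
  have "indexed_const \<one> \<notin> coeff_ideal V p" 
    using coeff_ideal_const_iff[OF p'] prime_idealD(2)[OF p] by auto
  thus "carrier (mpoly_ring V) \<noteq> coeff_ideal V p" using indexed_const_closed by blast
  fix a b assume "a \<in> carrier (mpoly_ring V)" "b \<in> carrier (mpoly_ring V)"
    "a \<otimes>\<^bsub>mpoly_ring V\<^esub> b \<in> coeff_ideal V p"
  thus "a \<in> coeff_ideal V p \<or> b \<in> coeff_ideal V p"
    using coeff_ideal_cancel[OF p oneideal p' _ prime_saturated[OF p], of a V b]
      ideal_closed(6)[OF p'] by (auto simp: coeff_ideal_def mpoly_coeff_closed)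
qed

end

text \<open>The case \<open>p = 0\<close> of the primality of \<open>p[T]\<close>.\<close>

lemma (in domain) domain_mpoly_ring:
  fixes V :: "'v::linorder set" shows "domain (mpoly_ring V)"
proof -
  interpret P: cring "mpoly_ring V" by (rule cring_mpoly_ring)
  have "coeff_ideal V {\<zero>} = {\<zero>\<^bsub>mpoly_ring V\<^esub>}"
    using P.zero_closed by (auto simp: coeff_ideal_def mpoly_ring_simps indexed_const_def fun_eq_iff)
  thus ?thesis using coeff_ideal_prime[OF zeroprimeideal] P.zeroprimeideal_domainI by metis
qed

section \<open>Krull's principal ideal theorem for polynomial coefficients\<close>

text \<open>
  A form of Krull's principal ideal theorem.  The classical statement is the case of a constant
  \<open>h = x\<close> and \<open>g = 1\<close>, where the conclusion is absurd: so there is no prime \<open>p\<^sub>1\<close> with \<open>0 \<noteq> p\<^sub>1 \<subset> p\<close> when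
  \<open>p\<close> is minimal over \<open>x\<close>.  In general \<open>p\<close> is minimal over the ideal of coefficients of \<open>h\<close>, which may
  need many generators, and the annihilation hypothesis says that this ideal is nilpotent modulo
  \<open>h\<close> wherever \<open>g\<close> is invertible.
\<close>

lemma (in noetherian_domain) krull_principal_ideal_polynomials:
  fixes V :: "'v::linorder set"
  assumes h: "h \<in> carrier (mpoly_ring V)"
    and p: "primeideal p R" "range h \<subseteq> p"
    and minimal: "\<And>p'. primeideal p' R \<Longrightarrow> range h \<subseteq> p' \<Longrightarrow> p' \<subseteq> p \<Longrightarrow> p' = p"
    and p1: "primeideal p1 R" "p1 \<subset> p" "p1 \<noteq> {\<zero>}"
    and g: "g \<in> carrier (mpoly_ring V)"
    and annih: "\<And>m. \<exists>k::nat. indexed_const (h m) [^]\<^bsub>mpoly_ring V\<^esub> k \<otimes>\<^bsub>mpoly_ring V\<^esub> g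
      \<in> Idl\<^bsub>mpoly_ring V\<^esub> {h}"
  shows "g \<in> coeff_ideal V p"
proof (rule ccontr)
  assume gp: "g \<notin> coeff_ideal V p"
  let ?P = "mpoly_ring V"
  interpret P: cring ?P by (rule cring_mpoly_ring)
  interpret const: ring_hom_ring R ?P indexed_const by (rule indexed_const_hom_ring)
  define H where "H = Idl\<^bsub>?P\<^esub> {h}"
  have H: "ideal H ?P" unfolding H_def using h by (intro P.genideal_ideal) simp
  define Q where "Q = coeff_ideal V p"
  have Q: "primeideal Q ?P" unfolding Q_def by (rule coeff_ideal_prime[OF p(1)])
  have hQ: "h \<in> Q" using h p(2) by (auto simp: Q_def coeff_ideal_def)
  \<comment> \<open>The contraction to \<open>R\<close> of \<open>h\<close> extended to the localization at \<open>p[T]\<close>.\<close>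
  define I0 where "I0 = {r \<in> carrier R. indexed_const r \<in> P.saturation Q H}"
  have I0: "ideal I0 R" unfolding I0_def by (rule const.ideal_vimage[OF P.saturation_ideal[OF Q H]])
  have "p' = p" if p': "primeideal p' R" "I0 \<subseteq> p'" "p' \<subseteq> p" for p'
  proof (rule minimal[OF p'(1) _ p'(3)])
    show "range h \<subseteq> p'"
    proof
      fix x assume "x \<in> range h"
      then obtain m where x: "x = h m" by auto
      have xR: "x \<in> carrier R" unfolding x by (rule mpoly_coeff_closed[OF h])
      have xP: "indexed_const x \<in> carrier ?P" using xR by (rule indexed_const_closed)
      obtain k :: nat where "indexed_const x [^]\<^bsub>?P\<^esub> k \<otimes>\<^bsub>?P\<^esub> g \<in> H"
        using annih[of m] unfolding x H_def by blast
      hence "g \<otimes>\<^bsub>?P\<^esub> indexed_const (x [^] k) \<in> H"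
        using P.m_comm[OF P.nat_pow_closed[OF xP] g] const.hom_nat_pow[OF xR] by simp
      hence "x [^] k \<in> I0"
        unfolding I0_def using g gp xR indexed_const_closed[of "x [^] k" V]
        by (auto simp: Q_def intro!: P.saturationI)
      thus "x \<in> p'" using p'(2) prime_powD[OF p'(1) xR] by blast
    qed
  qed
  from descending_chain_stabilizes[where C = "symbolic_power p1", OF noetherian_ring_axioms p(1) I0 this
      symbolic_power_ideal[OF p1(1)] symbolic_power_Suc_subset[OF p1(1)]]
  obtain k where k: "symbolic_power p1 k \<subseteq> saturation p (symbolic_power p1 (Suc k) <+> I0)" by blast
  define q where "q = symbolic_power p1"
  have q: "ideal (q j) R" for j unfolding q_def by (rule symbolic_power_ideal[OF p1(1)])
  have p1q: "a \<otimes> b \<in> q (Suc j)" if "a \<in> p1" "b \<in> q j" for a b j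
    using symbolic_power_mult[OF p1(1) that(1)] that(2) by (simp add: q_def)
  have qsat: "saturation p1 (q j) \<subseteq> q j" for j unfolding q_def by (rule symbolic_power_saturated[OF p1(1)])
  have qanti: "coeff_ideal V (q l) \<subseteq> coeff_ideal V (q j)" if "j \<le> l" for j l
    unfolding q_def by (rule coeff_ideal_mono[OF symbolic_power_antimono[OF p1(1) that]])
  have qT: "ideal (coeff_ideal V (q j)) ?P" for j by (rule coeff_ideal_ideal[OF q])
  have hp1: "h \<notin> coeff_ideal V p1"
  proof
    assume "h \<in> coeff_ideal V p1"
    hence "range h \<subseteq> p1" by (auto simp: coeff_ideal_def)
    thus False using minimal[OF p1(1)] p1(2) by blast
  qed
  obtain G where G: "G \<subseteq> carrier R" "finite G" "q k = Idl G" using finetely_gen[OF q] by blast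
  define G' :: "('v multiset \<Rightarrow> 'a) set" where "G' = indexed_const ` G"
  define N where "N = coeff_ideal V (q (Suc k))"
  have N: "ideal N ?P" unfolding N_def by (rule qT)
  have G': "G' \<subseteq> carrier ?P" "finite G'"
    using G indexed_const_closed by (auto simp: G'_def)
  let ?gens = "N \<union> {c \<otimes>\<^bsub>?P\<^esub> x | c x. c \<in> Q \<and> x \<in> G'}"
  have gens: "?gens \<subseteq> carrier ?P"
    using P.ideal_closed(1)[OF N] P.ideal_closed(7)[OF P.prime_idealD(1)[OF Q]] G'(1) by auto
  have E: "ideal (Idl\<^bsub>?P\<^esub> ?gens) ?P" by (rule P.genideal_ideal[OF gens])
  have qk: "coeff_ideal V (q k) \<subseteq> Idl\<^bsub>?P\<^esub> G'"
  proof (rule coeff_ideal_subset[OF P.genideal_ideal[OF G'(1)]])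
    have "ideal {r \<in> carrier R. indexed_const r \<in> Idl\<^bsub>?P\<^esub> G'} R"
      by (rule const.ideal_vimage[OF P.genideal_ideal[OF G'(1)]])
    moreover have "G \<subseteq> {r \<in> carrier R. indexed_const r \<in> Idl\<^bsub>?P\<^esub> G'}"
      using G(1) P.genideal_self[OF G'(1)] by (auto simp: G'_def)
    ultimately have "q k \<subseteq> {r \<in> carrier R. indexed_const r \<in> Idl\<^bsub>?P\<^esub> G'}"
      unfolding G(3) by (rule genideal_minimal)
    thus "indexed_const c \<in> Idl\<^bsub>?P\<^esub> G'" if "c \<in> q k" for c using that by blast
  qed
  have "G' \<subseteq> P.saturation Q (Idl\<^bsub>?P\<^esub> ?gens)"
  proof
    fix y' assume "y' \<in> G'"
    then obtain y where y: "y \<in> G" "y' = indexed_const y" by (auto simp: G'_def)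
    have yR: "y \<in> carrier R" and yq: "y \<in> q k" using y(1) G genideal_self[OF G(1)] by auto
    obtain s where s: "s \<in> carrier R" "s \<notin> p" "s \<otimes> y \<in> q (Suc k) <+> I0"
      using k yq by (auto simp: q_def elim: saturationE)
    then obtain z r where z: "z \<in> q (Suc k)" "r \<in> I0" "s \<otimes> y = z \<oplus> r" by (auto simp: set_add_iff)
    have zR: "z \<in> carrier R" "r \<in> carrier R"
      using ideal_closed(7)[OF q z(1)] ideal_closed(7)[OF I0 z(2)] by auto
    obtain t where t: "t \<in> carrier ?P" "t \<notin> Q" "t \<otimes>\<^bsub>?P\<^esub> indexed_const r \<in> H"
      using z(2) by (auto simp: I0_def elim: P.saturationE)
    then obtain u where u: "u \<in> carrier ?P" "t \<otimes>\<^bsub>?P\<^esub> indexed_const r = u \<otimes>\<^bsub>?P\<^esub> h"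
      using P.cgenideal_eq_genideal[OF h] by (auto simp: H_def cgenideal_def)
    have sQ: "indexed_const s \<notin> Q"
      unfolding Q_def using coeff_ideal_const_iff[OF prime_idealD(1)[OF p(1)] s(1), of V] s(2) by simp
    have car: "indexed_const s \<in> carrier ?P" "indexed_const y \<in> carrier ?P"
      "indexed_const z \<in> carrier ?P" "indexed_const r \<in> carrier ?P"
      using s(1) yR zR by (simp_all add: indexed_const_closed)
    have main: "(t \<otimes>\<^bsub>?P\<^esub> indexed_const s) \<otimes>\<^bsub>?P\<^esub> indexed_const y
      = t \<otimes>\<^bsub>?P\<^esub> indexed_const z \<oplus>\<^bsub>?P\<^esub> h \<otimes>\<^bsub>?P\<^esub> u"
    proof -
      have "(t \<otimes>\<^bsub>?P\<^esub> indexed_const s) \<otimes>\<^bsub>?P\<^esub> indexed_const y = t \<otimes>\<^bsub>?P\<^esub> indexed_const (s \<otimes> y)"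
        using t(1) car s(1) yR by (simp add: P.m_assoc)
      also have "\<dots> = t \<otimes>\<^bsub>?P\<^esub> indexed_const z \<oplus>\<^bsub>?P\<^esub> t \<otimes>\<^bsub>?P\<^esub> indexed_const r"
        using t(1) car zR by (simp add: z(3) P.r_distr)
      finally show ?thesis unfolding u(2) using P.m_comm[OF u(1) h] by simp
    qed
    have zq: "t \<otimes>\<^bsub>?P\<^esub> indexed_const z \<in> N"
      using P.ideal_closed(5)[OF N _ t(1)] coeff_ideal_const_iff[OF q zR(1), of V] z(1) by (simp add: N_def)
    have "h \<otimes>\<^bsub>?P\<^esub> u = (t \<otimes>\<^bsub>?P\<^esub> indexed_const s) \<otimes>\<^bsub>?P\<^esub> indexed_const y \<ominus>\<^bsub>?P\<^esub> t \<otimes>\<^bsub>?P\<^esub> indexed_const z"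
      unfolding main using t(1) car(3) h u(1) by algebra
    also have "\<dots> \<in> coeff_ideal V (q k)"
    proof (rule P.ideal_closed(4)[OF qT])
      show "t \<otimes>\<^bsub>?P\<^esub> indexed_const z \<in> coeff_ideal V (q k)"
        using zq qanti[of k "Suc k"] by (auto simp: N_def)
      show "(t \<otimes>\<^bsub>?P\<^esub> indexed_const s) \<otimes>\<^bsub>?P\<^esub> indexed_const y \<in> coeff_ideal V (q k)"
        using P.ideal_closed(5)[OF qT] coeff_ideal_const_iff[OF q yR, of V] yq t(1) car(1) by simp
    qed
    finally have hu: "h \<otimes>\<^bsub>?P\<^esub> u \<in> coeff_ideal V (q k)" .
    \<comment> \<open>Cancel \<open>h\<close> one symbolic power at a time, starting from \<open>q 0 = R\<close>.\<close>
    have "u \<in> coeff_ideal V (q j)" if "j \<le> k" for j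
      using that
    proof (induction j)
      case 0
      thus ?case using u(1) mpoly_coeff_closed[OF u(1)] by (simp add: q_def coeff_ideal_def)
    next
      case (Suc j)
      show ?case
      proof (rule coeff_ideal_cancel[OF p1(1) q q p1q qsat h hp1])
        show "u \<in> coeff_ideal V (q j)" using Suc by simp
        show "h \<otimes>\<^bsub>?P\<^esub> u \<in> coeff_ideal V (q (Suc j))" using hu qanti[OF Suc.prems] by blast
      qed
    qed
    hence "u \<in> Idl\<^bsub>?P\<^esub> G'" using qk by blast
    hence "h \<otimes>\<^bsub>?P\<^esub> u \<in> Idl\<^bsub>?P\<^esub> ?gens"
      by (rule P.mult_mem_genideal_products[OF N G'(1) P.prime_idealD(1)[OF Q] hQ])
    moreover have "t \<otimes>\<^bsub>?P\<^esub> indexed_const z \<in> Idl\<^bsub>?P\<^esub> ?gens" using zq P.genideal_self[OF gens] by blast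
    ultimately have "(t \<otimes>\<^bsub>?P\<^esub> indexed_const s) \<otimes>\<^bsub>?P\<^esub> y' \<in> Idl\<^bsub>?P\<^esub> ?gens"
      unfolding y(2) main using P.ideal_closed(3)[OF E] by blast
    moreover have "t \<otimes>\<^bsub>?P\<^esub> indexed_const s \<in> carrier ?P - Q" using P.prime_idealD(3)[OF Q] t car sQ by blast
    ultimately show "y' \<in> P.saturation Q (Idl\<^bsub>?P\<^esub> ?gens)"
      using car(2) y(2) by (auto intro!: P.saturationI[of "t \<otimes>\<^bsub>?P\<^esub> indexed_const s"])
  qed
  hence nak: "G' \<subseteq> P.saturation Q N" by (rule P.nakayama_saturation[OF Q N G'(2,1)])
  \<comment> \<open>Denominators outside \<open>p[T]\<close> are outside \<open>p1[T]\<close> and can be cancelled, since \<open>q (Suc k)\<close> is \<open>p1\<close>-primary.\<close>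
  have "G \<subseteq> q (Suc k)"
  proof
    fix y assume y: "y \<in> G"
    hence yR: "y \<in> carrier R" and yq: "y \<in> q k" using G genideal_self[OF G(1)] by auto
    have "indexed_const y \<in> P.saturation Q N" using nak y unfolding G'_def by auto
    then obtain s where s: "s \<in> carrier ?P" "s \<notin> Q" "s \<otimes>\<^bsub>?P\<^esub> indexed_const y \<in> N"
      by (rule P.saturationE)
    have "coeff_ideal V p1 \<subseteq> Q" using p1(2) unfolding Q_def by (intro coeff_ideal_mono) simp
    hence sp1: "s \<notin> coeff_ideal V p1" using s(2) by (rule contra_subsetD)
    have "indexed_const y \<in> coeff_ideal V (q (Suc k))"
    proof (rule coeff_ideal_cancel[OF p1(1) q q p1q qsat s(1) sp1])
      show "indexed_const y \<in> coeff_ideal V (q k)" using coeff_ideal_const_iff[OF q yR, of V] yq by blast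
      show "s \<otimes>\<^bsub>?P\<^esub> indexed_const y \<in> coeff_ideal V (q (Suc k))" using s(3) by (simp add: N_def)
    qed
    thus "y \<in> q (Suc k)" using coeff_ideal_const_iff[OF q yR, of V] by blast
  qed
  hence "q k \<subseteq> q (Suc k)" unfolding G(3) by (rule genideal_minimal[OF q])
  hence "p1 = {\<zero>}" unfolding q_def by (rule symbolic_power_stationary_imp_zero[OF p1(1)])
  thus False using p1(3) by blast
qed

section \<open>Elimination of a variable\<close>

context cring
begin

text \<open>Modulo \<open>h = c T\<^sub>i + h'\<close> one may replace \<open>c T\<^sub>i\<close> by \<open>- h'\<close>; each occurrence of \<open>T\<^sub>i\<close> costs one factor \<open>c\<close>.\<close>

lemma eliminate_variable:
  assumes i: "i \<in> V" and c: "c \<in> carrier R" and h': "h' \<in> carrier (mpoly_ring (V - {i}))"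
    and h: "h = indexed_const c \<otimes>\<^bsub>mpoly_ring V\<^esub> indexed_var i \<oplus>\<^bsub>mpoly_ring V\<^esub> h'"
    and g: "g \<in> carrier (mpoly_ring V)"
  shows "\<exists>d::nat. \<exists>G\<in>carrier (mpoly_ring (V - {i})).
    indexed_const c [^]\<^bsub>mpoly_ring V\<^esub> d \<otimes>\<^bsub>mpoly_ring V\<^esub> g \<ominus>\<^bsub>mpoly_ring V\<^esub> G \<in> Idl\<^bsub>mpoly_ring V\<^esub> {h}"
proof -
  let ?P = "mpoly_ring V"
  let ?V' = "V - {i}"
  let ?c = "indexed_const c"
  interpret P: cring ?P by (rule cring_mpoly_ring)
  interpret P': cring "mpoly_ring ?V'" by (rule cring_mpoly_ring)
  interpret const: ring_hom_ring R ?P indexed_const by (rule indexed_const_hom_ring)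
  have sub: "x \<in> carrier ?P" if "x \<in> carrier (mpoly_ring ?V')" for x
    using mpoly_mono_vars[OF _ that, of V] by auto
  have mult': "x \<otimes>\<^bsub>?P\<^esub> y \<in> carrier (mpoly_ring ?V')"
    if "x \<in> carrier (mpoly_ring ?V')" "y \<in> carrier (mpoly_ring ?V')" for x y
    using P'.m_closed[OF that] by (simp add: mpoly_ring_simps)
  have add': "x \<oplus>\<^bsub>?P\<^esub> y \<in> carrier (mpoly_ring ?V')"
    if "x \<in> carrier (mpoly_ring ?V')" "y \<in> carrier (mpoly_ring ?V')" for x y
    using P'.add.m_closed[OF that] by (simp add: mpoly_ring_simps)
  have cP: "?c \<in> carrier ?P" using c by (rule indexed_const_closed)
  have cpow: "?c [^]\<^bsub>?P\<^esub> (d::nat) \<in> carrier (mpoly_ring ?V')" for d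
    unfolding const.hom_nat_pow[OF c, symmetric] by (rule indexed_const_closed) (use c in simp)
  have hP: "h \<in> carrier ?P" unfolding h using cP indexed_var_closed[OF i] sub[OF h'] by auto
  define H where "H = Idl\<^bsub>?P\<^esub> {h}"
  have H: "ideal H ?P" unfolding H_def using P.genideal_ideal[of "{h}"] hP by auto
  note H' = P.ideal_closed[OF H]
  have hH: "h \<in> H" unfolding H_def using P.genideal_self'[OF hP] .
  have "g \<in> indexed_pset V (carrier R)" using g by (simp add: mpoly_ring_simps)
  thus ?thesis unfolding H_def[symmetric]
  proof induction
    case (indexed_const k)
    have k: "indexed_const k \<in> carrier ?P" using indexed_const by (rule indexed_const_closed)
    have "?c [^]\<^bsub>?P\<^esub> (0::nat) \<otimes>\<^bsub>?P\<^esub> indexed_const k \<ominus>\<^bsub>?P\<^esub> indexed_const k = \<zero>\<^bsub>?P\<^esub>"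
      using k by simp
    thus ?case using H'(2) indexed_const_closed[OF indexed_const, of ?V'] by metis
  next
    case (indexed_padd g g')
    then obtain d e :: nat and G G' where
      G: "G \<in> carrier (mpoly_ring ?V')" "?c [^]\<^bsub>?P\<^esub> d \<otimes>\<^bsub>?P\<^esub> g \<ominus>\<^bsub>?P\<^esub> G \<in> H" and
      G': "G' \<in> carrier (mpoly_ring ?V')" "?c [^]\<^bsub>?P\<^esub> e \<otimes>\<^bsub>?P\<^esub> g' \<ominus>\<^bsub>?P\<^esub> G' \<in> H" by blast
    have car: "g \<in> carrier ?P" "g' \<in> carrier ?P" "G \<in> carrier ?P" "G' \<in> carrier ?P"
      "?c [^]\<^bsub>?P\<^esub> d \<in> carrier ?P" "?c [^]\<^bsub>?P\<^esub> e \<in> carrier ?P"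
      using indexed_padd.hyps G(1) G'(1) sub P.nat_pow_closed[OF cP]
      by (auto simp: mpoly_ring_simps(1))
    let ?G = "?c [^]\<^bsub>?P\<^esub> e \<otimes>\<^bsub>?P\<^esub> G \<oplus>\<^bsub>?P\<^esub> ?c [^]\<^bsub>?P\<^esub> d \<otimes>\<^bsub>?P\<^esub> G'"
    have "?c [^]\<^bsub>?P\<^esub> (d + e) \<otimes>\<^bsub>?P\<^esub> (g \<oplus>\<^bsub>?P\<^esub> g') \<ominus>\<^bsub>?P\<^esub> ?G
      = (?c [^]\<^bsub>?P\<^esub> d \<otimes>\<^bsub>?P\<^esub> ?c [^]\<^bsub>?P\<^esub> e) \<otimes>\<^bsub>?P\<^esub> (g \<oplus>\<^bsub>?P\<^esub> g') \<ominus>\<^bsub>?P\<^esub> ?G"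
      using cP by (simp add: P.nat_pow_mult)
    also have "\<dots> = ?c [^]\<^bsub>?P\<^esub> e \<otimes>\<^bsub>?P\<^esub> (?c [^]\<^bsub>?P\<^esub> d \<otimes>\<^bsub>?P\<^esub> g \<ominus>\<^bsub>?P\<^esub> G) \<oplus>\<^bsub>?P\<^esub>
      ?c [^]\<^bsub>?P\<^esub> d \<otimes>\<^bsub>?P\<^esub> (?c [^]\<^bsub>?P\<^esub> e \<otimes>\<^bsub>?P\<^esub> g' \<ominus>\<^bsub>?P\<^esub> G')"
      using car by algebra
    also have "\<dots> \<in> H" by (rule H'(3)[OF H'(5)[OF G(2) car(6)] H'(5)[OF G'(2) car(5)]])
    finally have "?c [^]\<^bsub>?P\<^esub> (d + e) \<otimes>\<^bsub>?P\<^esub> indexed_padd g g' \<ominus>\<^bsub>?P\<^esub> ?G \<in> H"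
      by (simp add: mpoly_ring_simps(3))
    moreover have "?G \<in> carrier (mpoly_ring ?V')" by (intro add' mult' cpow G(1) G'(1))
    ultimately show ?case by blast
  next
    case (indexed_pmult g j)
    then obtain d :: nat and G where
      G: "G \<in> carrier (mpoly_ring ?V')" "?c [^]\<^bsub>?P\<^esub> d \<otimes>\<^bsub>?P\<^esub> g \<ominus>\<^bsub>?P\<^esub> G \<in> H" by blast
    let ?x = "indexed_var j"
    have car: "g \<in> carrier ?P" "G \<in> carrier ?P" "?c [^]\<^bsub>?P\<^esub> d \<in> carrier ?P" "?x \<in> carrier ?P"
      using indexed_pmult.hyps G(1) sub P.nat_pow_closed[OF cP] indexed_var_closed
      by (auto simp: mpoly_ring_simps(1))
    have eq: "indexed_pmult g j = ?x \<otimes>\<^bsub>?P\<^esub> g"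
      using indexed_pmult_eq_var_mult[OF car(1)] by (simp add: mpoly_ring_simps)
    show ?case
    proof (cases "j = i")
      case False
      have "?c [^]\<^bsub>?P\<^esub> d \<otimes>\<^bsub>?P\<^esub> (?x \<otimes>\<^bsub>?P\<^esub> g) \<ominus>\<^bsub>?P\<^esub> ?x \<otimes>\<^bsub>?P\<^esub> G
        = ?x \<otimes>\<^bsub>?P\<^esub> (?c [^]\<^bsub>?P\<^esub> d \<otimes>\<^bsub>?P\<^esub> g \<ominus>\<^bsub>?P\<^esub> G)" using car by algebra
      also have "\<dots> \<in> H" using H'(5) G(2) car(4) by blast
      finally have "?c [^]\<^bsub>?P\<^esub> d \<otimes>\<^bsub>?P\<^esub> (?x \<otimes>\<^bsub>?P\<^esub> g) \<ominus>\<^bsub>?P\<^esub> ?x \<otimes>\<^bsub>?P\<^esub> G \<in> H" .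
      moreover have "?x \<in> carrier (mpoly_ring ?V')"
        using False indexed_pmult.hyps(2) by (intro indexed_var_closed) auto
      hence "?x \<otimes>\<^bsub>?P\<^esub> G \<in> carrier (mpoly_ring ?V')" using G(1) by (rule mult')
      ultimately show ?thesis unfolding eq by blast
    next
      case True
      \<comment> \<open>The representative is \<open>- h' G\<close>; the sign is a constant so that membership in the smaller ring is plain.\<close>
      let ?G = "indexed_const (\<ominus> \<one>) \<otimes>\<^bsub>?P\<^esub> (h' \<otimes>\<^bsub>?P\<^esub> G)"
      have h'P: "h' \<in> carrier ?P" using sub[OF h'] .
      have m1: "indexed_const (\<ominus> \<one>) = \<ominus>\<^bsub>?P\<^esub> \<one>\<^bsub>?P\<^esub>" by simp
      have "?c [^]\<^bsub>?P\<^esub> Suc d \<otimes>\<^bsub>?P\<^esub> (?x \<otimes>\<^bsub>?P\<^esub> g) \<ominus>\<^bsub>?P\<^esub> ?G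
        = (?c [^]\<^bsub>?P\<^esub> d \<otimes>\<^bsub>?P\<^esub> ?c) \<otimes>\<^bsub>?P\<^esub> (?x \<otimes>\<^bsub>?P\<^esub> g) \<ominus>\<^bsub>?P\<^esub> ?G" by simp
      also have "\<dots> = (?c \<otimes>\<^bsub>?P\<^esub> ?x) \<otimes>\<^bsub>?P\<^esub> (?c [^]\<^bsub>?P\<^esub> d \<otimes>\<^bsub>?P\<^esub> g \<ominus>\<^bsub>?P\<^esub> G) \<oplus>\<^bsub>?P\<^esub>
          G \<otimes>\<^bsub>?P\<^esub> (?c \<otimes>\<^bsub>?P\<^esub> ?x \<oplus>\<^bsub>?P\<^esub> h')"
        unfolding m1 using car h'P cP by algebra
      also have "?c \<otimes>\<^bsub>?P\<^esub> ?x \<oplus>\<^bsub>?P\<^esub> h' = h" using h True by simp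
      also have "(?c \<otimes>\<^bsub>?P\<^esub> ?x) \<otimes>\<^bsub>?P\<^esub> (?c [^]\<^bsub>?P\<^esub> d \<otimes>\<^bsub>?P\<^esub> g \<ominus>\<^bsub>?P\<^esub> G) \<oplus>\<^bsub>?P\<^esub> G \<otimes>\<^bsub>?P\<^esub> h \<in> H"
        by (rule H'(3)[OF H'(5)[OF G(2) P.m_closed[OF cP car(4)]] H'(5)[OF hH car(2)]])
      finally have "?c [^]\<^bsub>?P\<^esub> Suc d \<otimes>\<^bsub>?P\<^esub> (?x \<otimes>\<^bsub>?P\<^esub> g) \<ominus>\<^bsub>?P\<^esub> ?G \<in> H" .
      moreover have "?G \<in> carrier (mpoly_ring ?V')"
        by (intro mult' indexed_const_closed h' G(1)) simp
      ultimately show ?thesis unfolding eq by blast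
    qed
  qed
qed

end

text \<open>
  In \<open>u h\<close> with \<open>u \<noteq> 0\<close> the terms of highest degree in \<open>T\<^sub>i\<close> come from \<open>c T\<^sub>i\<close> times those of \<open>u\<close>, so they
  survive and involve \<open>T\<^sub>i\<close>.
\<close>

lemma (in domain) principal_ideal_meets_other_variables_trivially:
  assumes i: "i \<in> V" and c: "c \<in> carrier R" "c \<noteq> \<zero>"
    and h': "h' \<in> carrier (mpoly_ring (V - {i}))"
    and h: "h = indexed_const c \<otimes>\<^bsub>mpoly_ring V\<^esub> indexed_var i \<oplus>\<^bsub>mpoly_ring V\<^esub> h'"
  shows "Idl\<^bsub>mpoly_ring V\<^esub> {h} \<inter> carrier (mpoly_ring (V - {i})) \<subseteq> {\<zero>\<^bsub>mpoly_ring V\<^esub>}"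
proof
  let ?P = "mpoly_ring V"
  interpret P: cring ?P by (rule cring_mpoly_ring)
  have h'P: "h' \<in> carrier ?P" using mpoly_mono_vars[OF _ h', of V] by auto
  have cP: "indexed_const c \<in> carrier ?P" and xP: "indexed_var i \<in> carrier ?P"
    using c i by (auto simp: indexed_const_closed indexed_var_closed)
  have hP: "h \<in> carrier ?P" unfolding h using cP xP h'P by auto
  fix v assume v: "v \<in> Idl\<^bsub>?P\<^esub> {h} \<inter> carrier (mpoly_ring (V - {i}))"
  then obtain u where u: "u \<in> carrier ?P" "v = u \<otimes>\<^bsub>?P\<^esub> h"
    using P.cgenideal_eq_genideal[OF hP] by (auto simp: cgenideal_def)
  have uc: "u m \<in> carrier R" for m by (rule mpoly_coeff_closed[OF u(1)])
  have "v = indexed_const c \<otimes>\<^bsub>?P\<^esub> (indexed_var i \<otimes>\<^bsub>?P\<^esub> u) \<oplus>\<^bsub>?P\<^esub> h' \<otimes>\<^bsub>?P\<^esub> u"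
    unfolding u(2) h using u(1) cP xP h'P by algebra
  also have "indexed_var i \<otimes>\<^bsub>?P\<^esub> u = indexed_pmult u i"
    using indexed_pmult_eq_var_mult[OF u(1)] by (simp add: mpoly_ring_simps)
  finally have v_eq: "v = indexed_padd (\<lambda>m. c \<otimes> indexed_pmult u i m) (indexed_mult h' u)"
    using c uc by (simp add: mpoly_ring_simps indexed_mult_const carrier_coeff_def indexed_pmult_def)
  show "v \<in> {\<zero>\<^bsub>?P\<^esub>}"
  proof (cases "{m. u m \<noteq> \<zero>} = {}")
    case True
    hence "u = \<zero>\<^bsub>?P\<^esub>" by (auto simp: mpoly_ring_simps indexed_const_def)
    thus ?thesis using u(2) hP by simp
  next
    case False
    let ?S = "{m. u m \<noteq> \<zero>}"
    define D where "D = Max ((\<lambda>m. count m i) ` ?S)"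
    have fin: "finite ((\<lambda>m. count m i) ` ?S)" using mpoly_finite_support[OF u(1)] by simp
    have "D \<in> (\<lambda>m. count m i) ` ?S" unfolding D_def using fin False by (intro Max_in) auto
    then obtain m where m: "u m \<noteq> \<zero>" "count m i = D" by auto
    have top: "count k i \<le> D" if "u k \<noteq> \<zero>" for k
      unfolding D_def using fin that by (intro Max_ge) auto
    have "indexed_mult h' u (add_mset i m) = (\<Oplus>a\<in>{a. a \<subseteq># add_mset i m}. \<zero>)"
      unfolding indexed_mult_def
    proof (rule finsum_cong')
      fix a assume a: "a \<in> {a. a \<subseteq># add_mset i m}"
      show "h' a \<otimes> u (add_mset i m - a) = \<zero>"
      proof (cases "h' a = \<zero>")
        case False
        hence "i \<notin># a" using mpoly_support_vars[OF h' False] by auto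
        hence "count (add_mset i m - a) i = Suc D" using m(2) by (simp add: not_in_iff)
        hence "u (add_mset i m - a) = \<zero>" using top[of "add_mset i m - a"] by auto
        thus ?thesis using mpoly_coeff_closed[OF h'] by simp
      qed (use uc in simp)
    qed auto
    hence "v (add_mset i m) = c \<otimes> u m"
      using c uc by (simp add: v_eq indexed_padd_def indexed_pmult_def)
    hence "v (add_mset i m) \<noteq> \<zero>" using c uc m(1) by (simp add: integral_iff)
    hence "i \<in> V - {i}" using mpoly_support_vars[of v "V - {i}" "add_mset i m"] v by auto
    thus ?thesis by simp
  qed
qed

context domain
begin

text \<open>
  The next two lemmas are the arithmetic of the domain \<open>R/H\<close> localized at \<open>c\<close>, where every element is,
  up to a power of \<open>c\<close>, represented by an element of \<open>S\<close>, and \<open>S\<close> embeds.  Here: whatever is killed by some nonzero element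
  of \<open>S\<close> is killed by a power of \<open>c\<close>.  It serves to pass from one coefficient \<open>c\<close> of \<open>h\<close> to another.
\<close>

lemma torsion_by_elimination:
  assumes H: "ideal H R" and S: "S \<subseteq> carrier R" "\<And>x y. x \<in> S \<Longrightarrow> y \<in> S \<Longrightarrow> x \<otimes> y \<in> S"
    and SH: "H \<inter> S \<subseteq> {\<zero>}" and c: "c \<in> S"
    and elim: "\<And>g. g \<in> carrier R \<Longrightarrow> \<exists>d::nat. \<exists>G\<in>S. c [^] d \<otimes> g \<ominus> G \<in> H"
    and a: "a \<in> S" "a \<noteq> \<zero>" and g: "g \<in> carrier R" "a \<otimes> g \<in> H"
  shows "\<exists>d::nat. c [^] d \<otimes> g \<in> H"
proof -
  obtain d :: nat and G where G: "G \<in> S" "c [^] d \<otimes> g \<ominus> G \<in> H" using elim[OF g(1)] by blast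
  have car: "G \<in> carrier R" "a \<in> carrier R" "c [^] d \<in> carrier R" using G(1) a(1) c S(1) by auto
  have "a \<otimes> G = c [^] d \<otimes> (a \<otimes> g) \<ominus> a \<otimes> (c [^] d \<otimes> g \<ominus> G)" using car g(1) by algebra
  also have "\<dots> \<in> H"
    by (rule ideal_closed(4)[OF H ideal_closed(5)[OF H g(2) car(3)] ideal_closed(5)[OF H G(2) car(2)]])
  finally have "a \<otimes> G = \<zero>" using SH S(2)[OF a(1) G(1)] by blast
  hence "G = \<zero>" using integral_iff[OF car(2,1)] a(2) by simp
  moreover have "c [^] d \<otimes> g \<ominus> \<zero> = c [^] d \<otimes> g" using car(3) g(1) by algebra
  ultimately have "c [^] d \<otimes> g \<in> H" using G(2) by simp
  thus ?thesis by blast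
qed

text \<open>
  If \<open>c\<^sup>k a b \<in> H\<close> and \<open>G\<close>, \<open>G'\<close> in \<open>S\<close> represent \<open>a\<close>, \<open>b\<close> up to powers of \<open>c\<close>, then \<open>c\<^sup>k G G'\<close> lies in
  \<open>H \<inter> S = 0\<close>, so one of \<open>G\<close>, \<open>G'\<close> vanishes.
\<close>

lemma torsion_prime_by_elimination:
  assumes H: "ideal H R" and S: "S \<subseteq> carrier R" "\<And>x y. x \<in> S \<Longrightarrow> y \<in> S \<Longrightarrow> x \<otimes> y \<in> S" "\<one> \<in> S"
    and SH: "H \<inter> S \<subseteq> {\<zero>}" and c: "c \<in> S" "c \<noteq> \<zero>"
    and elim: "\<And>g. g \<in> carrier R \<Longrightarrow> \<exists>d::nat. \<exists>G\<in>S. c [^] d \<otimes> g \<ominus> G \<in> H"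
  shows "primeideal {g \<in> carrier R. \<exists>k::nat. c [^] k \<otimes> g \<in> H} R" (is "primeideal ?Q R")
proof (rule primeidealI)
  note H' = ideal_closed[OF H]
  have cc: "c \<in> carrier R" using c(1) S(1) by blast
  have cS: "c [^] (k::nat) \<in> S" for k by (induction k) (use S c in auto)
  have c0: "c [^] (k::nat) \<noteq> \<zero>" for k using nat_pow_nonzero[OF cc c(2)] .
  show "ideal ?Q R"
  proof (rule ideal_by_closure)
    have "c [^] (0::nat) \<otimes> \<zero> \<in> H" using H'(2) by simp
    thus "\<zero> \<in> ?Q" by blast
    fix a b assume "a \<in> ?Q"
    then obtain k :: nat where a: "a \<in> carrier R" "c [^] k \<otimes> a \<in> H" by auto
    { assume "b \<in> ?Q"
      then obtain l :: nat where b: "b \<in> carrier R" "c [^] l \<otimes> b \<in> H" by auto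
      have car: "c [^] k \<in> carrier R" "c [^] l \<in> carrier R" using cc by auto
      have "c [^] (k + l) \<otimes> (a \<oplus> b) = (c [^] k \<otimes> c [^] l) \<otimes> (a \<oplus> b)" using cc by (simp add: nat_pow_mult)
      also have "\<dots> = c [^] l \<otimes> (c [^] k \<otimes> a) \<oplus> c [^] k \<otimes> (c [^] l \<otimes> b)" using car a(1) b(1) by algebra
      also have "\<dots> \<in> H" by (rule H'(3)[OF H'(5)[OF a(2) car(2)] H'(5)[OF b(2) car(1)]])
      finally show "a \<oplus> b \<in> ?Q" using a b by blast }
    fix x assume x: "x \<in> carrier R"
    have "c [^] k \<in> carrier R" using cc by auto
    hence "c [^] k \<otimes> (x \<otimes> a) = x \<otimes> (c [^] k \<otimes> a)" using a(1) x by algebra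
    also have "\<dots> \<in> H" by (rule H'(5)[OF a(2) x])
    finally show "x \<otimes> a \<in> ?Q" using x a by blast
  qed auto
  show "cring R" by (rule is_cring)
  have "\<one> \<notin> ?Q"
  proof
    assume "\<one> \<in> ?Q"
    then obtain k :: nat where "c [^] k \<in> H" using cc by auto
    thus False using SH cS[of k] c0[of k] by blast
  qed
  thus "carrier R \<noteq> ?Q" by blast
  fix a b assume a: "a \<in> carrier R" and b: "b \<in> carrier R" and "a \<otimes> b \<in> ?Q"
  then obtain k :: nat where k: "c [^] k \<otimes> (a \<otimes> b) \<in> H" by auto
  obtain d :: nat and G where G: "G \<in> S" "c [^] d \<otimes> a \<ominus> G \<in> H" using elim[OF a] by blast
  obtain e :: nat and G' where G': "G' \<in> S" "c [^] e \<otimes> b \<ominus> G' \<in> H" using elim[OF b] by blast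
  have car: "G \<in> carrier R" "G' \<in> carrier R" "c [^] k \<in> carrier R" "c [^] d \<in> carrier R"
    "c [^] e \<in> carrier R" using G(1) G'(1) S(1) cc by auto
  have "c [^] k \<otimes> (G \<otimes> G') = (c [^] d \<otimes> c [^] e) \<otimes> (c [^] k \<otimes> (a \<otimes> b))
      \<ominus> ((c [^] k \<otimes> (c [^] d \<otimes> a)) \<otimes> (c [^] e \<otimes> b \<ominus> G') \<oplus> (c [^] k \<otimes> G') \<otimes> (c [^] d \<otimes> a \<ominus> G))"
    using car a b by algebra
  also have "\<dots> \<in> H"
    using car a b by (intro H'(4) H'(3) H'(5) k G(2) G'(2) m_closed)
  finally have "c [^] k \<otimes> (G \<otimes> G') \<in> H" .
  moreover have "c [^] k \<otimes> (G \<otimes> G') \<in> S" using S(2) cS G(1) G'(1) by blast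
  ultimately have "c [^] k \<otimes> (G \<otimes> G') = \<zero>" using SH by blast
  hence "G = \<zero> \<or> G' = \<zero>" using c0[of k] car by (auto simp: integral_iff)
  moreover have "c [^] d \<otimes> a \<ominus> \<zero> = c [^] d \<otimes> a" "c [^] e \<otimes> b \<ominus> \<zero> = c [^] e \<otimes> b"
    using car a b by algebra+
  ultimately have "c [^] d \<otimes> a \<in> H \<or> c [^] e \<otimes> b \<in> H" using G(2) G'(2) by auto
  thus "a \<in> ?Q \<or> b \<in> ?Q" using a b by blast
qed

end

section \<open>Heights and quotients\<close>

lemma two_le_prime_heightD:
  fixes R :: "('a, 'b) ring_scheme" (structure)
  assumes "cring R" "2 \<le> prime_height R p"
  shows "\<exists>p1. primeideal p1 R \<and> p1 \<subset> p \<and> p1 \<noteq> {\<zero>}"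
proof -
  interpret cring R by fact
  let ?A = "{enat k | k. \<exists>C :: nat \<Rightarrow> 'a set.
    (\<forall>i\<le>k. primeideal (C i) R) \<and> (\<forall>i<k. C i \<subset> C (Suc i)) \<and> C k = p}"
  have "\<exists>a\<in>?A. 1 < a"
  proof (rule ccontr)
    assume "\<not> (\<exists>a\<in>?A. 1 < a)"
    hence "Sup ?A \<le> 1" by (intro Sup_least) (meson not_le)
    hence "(2::enat) \<le> 1" using assms(2) unfolding prime_height_def by (rule order_trans[rotated])
    thus False by (simp add: one_enat_def numeral_eq_enat)
  qed
  then obtain k C where k: "1 < enat k" "\<And>i. i \<le> k \<Longrightarrow> primeideal (C i) R"
    "\<And>i. i < k \<Longrightarrow> C i \<subset> C (Suc i)" "C k = p" by auto
  then obtain j where j: "k = Suc (Suc j)"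
    by (cases k; cases "k - 1") (auto simp: one_enat_def)
  have "\<zero> \<in> C j" using ideal_closed(2)[OF prime_idealD(1)[OF k(2)]] j by simp
  moreover have "C j \<subset> C (Suc j)" using k(3)[of j] j by simp
  ultimately have "C (Suc j) \<noteq> {\<zero>}" by auto
  thus ?thesis using k(2)[of "Suc j"] k(3)[of "Suc j"] k(4) j by auto
qed


text \<open>
  A least element among the primes over \<open>I\<close> is the only minimal one, and primes of the quotient
  correspond to primes over \<open>I\<close>.
\<close>

lemma irreducible_quotient:
  fixes R (structure)
  assumes "cring R" and I: "ideal I R" and Q0: "primeideal Q0 R" "I \<subseteq> Q0"
    and least: "\<And>Q. primeideal Q R \<Longrightarrow> I \<subseteq> Q \<Longrightarrow> Q0 \<subseteq> Q"
  shows "irreducible_ring (R Quot I)"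
proof -
  interpret cring R by fact
  interpret I: ideal I R by fact
  interpret \<pi>: ring_hom_ring R "R Quot I" "(+>) I" by (rule I.rcos_ring_hom_ring)
  let ?Q = "(+>) I ` Q0"
  have Qi: "ideal Q0 R" by (rule prime_idealD(1)[OF Q0(1)])
  have carr: "carrier (R Quot I) = (+>) I ` carrier R"
    unfolding FactRing_def using A_RCOSETS_def'[of R I] by auto
  have mem: "I +> x \<in> ?Q \<longleftrightarrow> x \<in> Q0" if x: "x \<in> carrier R" for x
  proof
    assume "I +> x \<in> ?Q"
    then obtain z where z: "z \<in> Q0" "I +> x = I +> z" by auto
    have zc: "z \<in> carrier R" using ideal_closed(7)[OF Qi z(1)] .
    have "x \<ominus> z \<in> Q0" using quotient_eq_iff_same_a_r_cos[OF I x zc] z(2) Q0(2) by auto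
    hence "x \<ominus> z \<oplus> z \<in> Q0" using z(1) ideal_closed(3)[OF Qi] by blast
    moreover have "x \<ominus> z \<oplus> z = x" using x zc by algebra
    ultimately show "x \<in> Q0" by simp
  qed auto
  have prime: "primeideal ?Q (R Quot I)"
  proof (rule primeidealI)
    show "ideal ?Q (R Quot I)" by (rule ring_ideal_imp_quot_ideal[OF I Qi])
    show "cring (R Quot I)" by (rule I.quotient_is_cring[OF is_cring])
    have "I +> \<one> \<in> carrier (R Quot I)" "I +> \<one> \<notin> ?Q"
      using mem[OF one_closed] prime_idealD(2)[OF Q0(1)] unfolding carr by blast+
    thus "carrier (R Quot I) \<noteq> ?Q" by blast
    fix a b assume "a \<in> carrier (R Quot I)" "b \<in> carrier (R Quot I)" "a \<otimes>\<^bsub>R Quot I\<^esub> b \<in> ?Q"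
    then obtain x y where xy: "x \<in> carrier R" "a = I +> x" "y \<in> carrier R" "b = I +> y"
      "(I +> x) \<otimes>\<^bsub>R Quot I\<^esub> (I +> y) \<in> ?Q" unfolding carr by auto
    hence "I +> (x \<otimes> y) \<in> ?Q" by simp
    hence "x \<otimes> y \<in> Q0" using mem[OF m_closed[OF xy(1,3)]] by blast
    thus "a \<in> ?Q \<or> b \<in> ?Q" using primeideal.I_prime[OF Q0(1) xy(1,3)] xy(2,4) by auto
  qed
  have le: "?Q \<subseteq> A" if A: "primeideal A (R Quot I)" for A
  proof -
    have "I \<subseteq> {r \<in> carrier R. I +> r \<in> A}"
    proof
      fix r assume r: "r \<in> I"
      have "ideal A (R Quot I)" using A by (simp add: primeideal_def)
      hence "\<zero>\<^bsub>R Quot I\<^esub> \<in> A" by (intro additive_subgroup.zero_closed ideal.axioms(1))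
      moreover have "\<zero>\<^bsub>R Quot I\<^esub> = I" unfolding FactRing_def by simp
      ultimately have "I +> r \<in> A" unfolding a_rcos_zero[OF I r] by simp
      thus "r \<in> {r \<in> carrier R. I +> r \<in> A}" using r by auto
    qed
    thus ?thesis using least[OF \<pi>.primeideal_vimage[OF is_cring A]] by auto
  qed
  show ?thesis unfolding irreducible_ring_def minimal_prime_ideal_def
  proof (intro ex1I[of _ ?Q] conjI allI impI)
    fix A assume "primeideal A (R Quot I) \<and> A \<subseteq> ?Q"
    thus "A = ?Q" using le[of A] by auto
  next
    fix A assume "primeideal A (R Quot I) \<and> (\<forall>B. primeideal B (R Quot I) \<and> B \<subseteq> A \<longrightarrow> B = A)"
    thus "A = ?Q" using prime le[of A] by metis
  qed (rule prime)
qed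

section \<open>Polynomials of degree one\<close>

definition (in ring) affine_poly :: "'v set \<Rightarrow> ('v \<Rightarrow> 'a) \<Rightarrow> 'a \<Rightarrow> ('v multiset \<Rightarrow> 'a)"
  where "affine_poly V f f0 = (\<Oplus>\<^bsub>mpoly_ring V\<^esub>i\<in>V. indexed_const (f i) \<otimes>\<^bsub>mpoly_ring V\<^esub> indexed_var i)
    \<oplus>\<^bsub>mpoly_ring V\<^esub> indexed_const f0"

context cring
begin

lemma affine_term_closed:
  assumes "f \<in> V \<rightarrow> carrier R" "i \<in> V"
  shows "indexed_const (f i) \<otimes>\<^bsub>mpoly_ring V\<^esub> indexed_var i \<in> carrier (mpoly_ring V)"
proof -
  interpret P: cring "mpoly_ring V" by (rule cring_mpoly_ring)
  show ?thesis using assms by (intro P.m_closed indexed_const_closed indexed_var_closed) auto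
qed

lemma affine_poly_closed:
  assumes "f \<in> V \<rightarrow> carrier R" "f0 \<in> carrier R"
  shows "affine_poly V f f0 \<in> carrier (mpoly_ring V)"
proof -
  interpret P: cring "mpoly_ring V" by (rule cring_mpoly_ring)
  show ?thesis unfolding affine_poly_def
    by (intro P.add.m_closed P.finsum_closed indexed_const_closed assms(2))
      (auto intro: affine_term_closed[OF assms(1)])
qed

lemma affine_poly_split:
  assumes V: "finite V" "i \<in> V" and f: "f \<in> V \<rightarrow> carrier R" "f0 \<in> carrier R"
  obtains h' where "h' \<in> carrier (mpoly_ring (V - {i}))"
    and "affine_poly V f f0
      = indexed_const (f i) \<otimes>\<^bsub>mpoly_ring V\<^esub> indexed_var i \<oplus>\<^bsub>mpoly_ring V\<^esub> h'"
proof -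
  let ?P = "mpoly_ring V"
  let ?P' = "mpoly_ring (V - {i})"
  let ?t = "\<lambda>i. indexed_const (f i) \<otimes>\<^bsub>?P\<^esub> indexed_var i"
  interpret P: cring ?P by (rule cring_mpoly_ring)
  interpret P': cring ?P' by (rule cring_mpoly_ring)
  have t: "?t j \<in> carrier ?P" if "j \<in> V" for j by (rule affine_term_closed[OF f(1) that])
  have t': "?t j \<in> carrier ?P'" if "j \<in> V - {i}" for j
    using affine_term_closed[of f "V - {i}" j] f(1) that by (auto simp: mpoly_ring_simps)
  have sum: "(\<Oplus>\<^bsub>?P\<^esub>j\<in>A. ?t j) \<in> carrier ?P'" if "finite A" "A \<subseteq> V - {i}" for A
    using that
  proof (induction A)
    case empty
    have "\<zero>\<^bsub>?P\<^esub> = \<zero>\<^bsub>?P'\<^esub>" by (simp add: mpoly_ring_simps)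
    thus ?case using P'.zero_closed by simp
  next
    case (insert j A)
    have "(\<Oplus>\<^bsub>?P\<^esub>j\<in>insert j A. ?t j) = ?t j \<oplus>\<^bsub>?P\<^esub> (\<Oplus>\<^bsub>?P\<^esub>j\<in>A. ?t j)"
      by (rule P.finsum_insert) (use insert t in auto)
    also have "\<dots> = ?t j \<oplus>\<^bsub>?P'\<^esub> (\<Oplus>\<^bsub>?P\<^esub>j\<in>A. ?t j)" by (simp add: mpoly_ring_simps)
    also have "\<dots> \<in> carrier ?P'" using insert by (intro P'.add.m_closed t') auto
    finally show ?case .
  qed
  let ?h' = "(\<Oplus>\<^bsub>?P\<^esub>j\<in>V - {i}. ?t j) \<oplus>\<^bsub>?P\<^esub> indexed_const f0"
  have sumP: "(\<Oplus>\<^bsub>?P\<^esub>j\<in>V - {i}. ?t j) \<in> carrier ?P" using t by auto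
  have "(\<Oplus>\<^bsub>?P\<^esub>j\<in>V. ?t j) = (\<Oplus>\<^bsub>?P\<^esub>j\<in>insert i (V - {i}). ?t j)" using V(2) by (simp add: insert_absorb)
  also have "\<dots> = ?t i \<oplus>\<^bsub>?P\<^esub> (\<Oplus>\<^bsub>?P\<^esub>j\<in>V - {i}. ?t j)"
    by (rule P.finsum_insert) (use V t in auto)
  finally have "affine_poly V f f0 = ?t i \<oplus>\<^bsub>?P\<^esub> ?h'"
    unfolding affine_poly_def
    using P.add.m_assoc[OF t[OF V(2)] sumP indexed_const_closed[OF f(2)]] by simp
  moreover have "?h' \<in> carrier ?P'"
    using P'.add.m_closed[OF sum[of "V - {i}"] indexed_const_closed[OF f(2)]] V(1)
    by (simp add: mpoly_ring_simps)
  ultimately show ?thesis using that by blast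
qed

text \<open>
  The constant term is \<open>h - (f\<^sub>1T\<^sub>1 + \<dots> + f\<^sub>nT\<^sub>n)\<close>.  Three ideals \<open>K\<close> matter below: primes over \<open>h\<close>, the
  ideals \<open>W[T]\<close>, and a radical.
\<close>

lemma const_term_mem_ideal:
  assumes f: "f \<in> V \<rightarrow> carrier R" "f0 \<in> carrier R" and K: "ideal K (mpoly_ring V)"
    and "affine_poly V f f0 \<in> K" and coeffs: "\<And>i. i \<in> V \<Longrightarrow> indexed_const (f i) \<in> K"
  shows "indexed_const f0 \<in> K"
proof -
  let ?P = "mpoly_ring V"
  interpret P: cring ?P by (rule cring_mpoly_ring)
  let ?S = "\<Oplus>\<^bsub>?P\<^esub>i\<in>V. indexed_const (f i) \<otimes>\<^bsub>?P\<^esub> indexed_var i"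
  have S: "?S \<in> K"
    using coeffs by (intro P.ideal_finsum_closed[OF K] P.ideal_closed(6)[OF K] indexed_var_closed)
  have "x \<oplus>\<^bsub>?P\<^esub> y \<ominus>\<^bsub>?P\<^esub> x = y" if "x \<in> carrier ?P" "y \<in> carrier ?P" for x y
    using that by algebra
  from this[OF P.ideal_closed(7)[OF K S] indexed_const_closed[OF f(2)]]
  have "affine_poly V f f0 \<ominus>\<^bsub>?P\<^esub> ?S = indexed_const f0" unfolding affine_poly_def .
  thus ?thesis using P.ideal_closed(4)[OF K assms(4) S] by simp
qed

lemma affine_poly_coeff_ideal_iff:
  assumes V: "finite V" and f: "f \<in> V \<rightarrow> carrier R" "f0 \<in> carrier R" and W: "ideal W R"
  shows "range (affine_poly V f f0) \<subseteq> W \<longleftrightarrow> insert f0 (f ` V) \<subseteq> W"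
proof
  let ?P = "mpoly_ring V"
  interpret P: cring ?P by (rule cring_mpoly_ring)
  note K = coeff_ideal_ideal[OF W, of V]
  { assume sub: "range (affine_poly V f f0) \<subseteq> W"
    have fi: "f i \<in> W" if i: "i \<in> V" for i
    proof -
      obtain h' where h': "h' \<in> carrier (mpoly_ring (V - {i}))"
        "affine_poly V f f0 = indexed_const (f i) \<otimes>\<^bsub>?P\<^esub> indexed_var i \<oplus>\<^bsub>?P\<^esub> h'"
        by (rule affine_poly_split[OF V i f])
      have "h' {#i#} = \<zero>" using mpoly_support_vars[OF h'(1), of "{#i#}"] by auto
      moreover have "indexed_mult (indexed_const (f i)) (indexed_var i) {#i#} = f i"
        using funcset_mem[OF f(1) i] indexed_pset_coeff[of "indexed_var i" V] indexed_var_closed[OF i]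
        by (subst indexed_mult_const)
          (auto simp: mpoly_ring_simps indexed_var_def indexed_pmult_def indexed_const_def)
      ultimately have "affine_poly V f f0 {#i#} = f i"
        using funcset_mem[OF f(1) i] by (auto simp: h'(2) mpoly_ring_simps indexed_padd_def)
      thus ?thesis using sub by (metis rangeI subsetD)
    qed
    have "affine_poly V f f0 \<in> coeff_ideal V W"
      using affine_poly_closed[OF f] sub by (auto simp: coeff_ideal_def)
    hence "indexed_const f0 \<in> coeff_ideal V W"
      using coeff_ideal_const_iff[OF W, of _ V] f fi by (intro const_term_mem_ideal[OF f K]) auto
    thus "insert f0 (f ` V) \<subseteq> W" using fi coeff_ideal_const_iff[OF W f(2), of V] by auto }
  assume sub: "insert f0 (f ` V) \<subseteq> W"
  have const: "indexed_const c \<in> coeff_ideal V W" if "c \<in> W" for c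
    using coeff_ideal_const_iff[OF W ideal_closed(7)[OF W that], of V] that by simp
  have "affine_poly V f f0 \<in> coeff_ideal V W"
    unfolding affine_poly_def using sub
    by (intro P.ideal_closed(3)[OF K] P.ideal_finsum_closed[OF K] P.ideal_closed(6)[OF K]
        indexed_var_closed const) auto
  thus "range (affine_poly V f f0) \<subseteq> W" by (auto simp: coeff_ideal_def)
qed

text \<open>
  The point is the constant term \<open>f\<^sub>0\<close>, which is not covered by the hypothesis.  The elements with a
  power annihilating \<open>g\<close> modulo \<open>h\<close> form an ideal, the radical of \<open>((h) : g)\<close>; it contains \<open>h\<close> and the
  \<open>f\<^sub>i\<close>, hence \<open>f\<^sub>0\<close>.
\<close>

lemma affine_coeff_power_annihilates:
  assumes V: "finite V" and f: "f \<in> V \<rightarrow> carrier R" "f0 \<in> carrier R"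
    and g: "g \<in> carrier (mpoly_ring V)"
    and annih: "\<And>i. i \<in> V \<Longrightarrow> \<exists>k::nat. indexed_const (f i) [^]\<^bsub>mpoly_ring V\<^esub> k \<otimes>\<^bsub>mpoly_ring V\<^esub> g
      \<in> Idl\<^bsub>mpoly_ring V\<^esub> {affine_poly V f f0}"
  shows "\<exists>k::nat. indexed_const (affine_poly V f f0 m) [^]\<^bsub>mpoly_ring V\<^esub> k \<otimes>\<^bsub>mpoly_ring V\<^esub> g
      \<in> Idl\<^bsub>mpoly_ring V\<^esub> {affine_poly V f f0}"
proof -
  let ?P = "mpoly_ring V"
  interpret P: cring ?P by (rule cring_mpoly_ring)
  interpret const: ring_hom_ring R ?P indexed_const by (rule indexed_const_hom_ring)
  have h: "affine_poly V f f0 \<in> carrier ?P" by (rule affine_poly_closed[OF f])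
  let ?H = "Idl\<^bsub>?P\<^esub> {affine_poly V f f0}"
  have H: "ideal ?H ?P" using h by (intro P.genideal_ideal) simp
  define K where "K = {x \<in> carrier ?P. \<exists>k::nat. x [^]\<^bsub>?P\<^esub> k \<in> {r \<in> carrier ?P. r \<otimes>\<^bsub>?P\<^esub> g \<in> ?H}}"
  have K: "ideal K ?P" unfolding K_def by (rule P.radical_ideal[OF P.colon_ideal[OF H g]])
  have K_iff: "x \<in> K \<longleftrightarrow> (\<exists>k::nat. x [^]\<^bsub>?P\<^esub> k \<otimes>\<^bsub>?P\<^esub> g \<in> ?H)" if "x \<in> carrier ?P" for x
    using that by (simp add: K_def)
  have "affine_poly V f f0 [^]\<^bsub>?P\<^esub> (1::nat) \<otimes>\<^bsub>?P\<^esub> g \<in> ?H"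
    using P.ideal_closed(6)[OF H P.genideal_self'[OF h] g] h by simp
  hence hK: "affine_poly V f f0 \<in> K" using K_iff[OF h] by blast
  have fK: "indexed_const (f i) \<in> K" if "i \<in> V" for i
    using K_iff[OF indexed_const_closed] annih[OF that] f(1) that by blast
  have "indexed_const f0 \<in> K" by (rule const_term_mem_ideal[OF f K hK fK])
  hence "insert f0 (f ` V) \<subseteq> {r \<in> carrier R. indexed_const r \<in> K}" using fK f by auto
  hence "range (affine_poly V f f0) \<subseteq> {r \<in> carrier R. indexed_const r \<in> K}"
    using affine_poly_coeff_ideal_iff[OF V f const.ideal_vimage[OF K]] by blast
  hence "affine_poly V f f0 m \<in> carrier R" "indexed_const (affine_poly V f f0 m) \<in> K" by auto
  thus ?thesis using K_iff[OF indexed_const_closed] by blast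
qed

end

section \<open>Irreducibility\<close>

text \<open>
  This is where the height hypothesis enters.  The conclusion is shown for a prime \<open>p \<subseteq> q\<close>
  minimal over the coefficients of \<open>h\<close>, since Krull's theorem needs minimality, and then passes to \<open>q\<close>.
\<close>

lemma (in noetherian_domain) torsion_mem_coeff_ideal:
  fixes V :: "'v::linorder set"
  assumes V: "finite V" and f: "f \<in> V \<rightarrow> carrier R" "f0 \<in> carrier R"
    and height: "ideal_height R (Idl (insert f0 (f ` V))) \<ge> 2"
    and q: "primeideal q R" "insert f0 (f ` V) \<subseteq> q"
    and g: "g \<in> carrier (mpoly_ring V)"
    and annih: "\<And>i. i \<in> V \<Longrightarrow> \<exists>k::nat. indexed_const (f i) [^]\<^bsub>mpoly_ring V\<^esub> k \<otimes>\<^bsub>mpoly_ring V\<^esub> g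
      \<in> Idl\<^bsub>mpoly_ring V\<^esub> {affine_poly V f f0}"
  shows "g \<in> coeff_ideal V q"
proof -
  have gens: "insert f0 (f ` V) \<subseteq> carrier R" using f by auto
  obtain p where p: "primeideal p R" "insert f0 (f ` V) \<subseteq> p" "p \<subseteq> q"
    and min: "\<forall>p'. primeideal p' R \<and> insert f0 (f ` V) \<subseteq> p' \<and> p' \<subseteq> p \<longrightarrow> p' = p"
    using exists_minimal_prime_over[OF q] by blast
  have "Idl (insert f0 (f ` V)) \<subseteq> p" by (rule genideal_minimal[OF prime_idealD(1)[OF p(1)] p(2)])
  hence "ideal_height R (Idl (insert f0 (f ` V))) \<le> prime_height R p"
    unfolding ideal_height_def using p(1) by (intro INF_lower) simp
  hence "2 \<le> prime_height R p" by (rule order_trans[OF height])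
  then obtain p1 where p1: "primeideal p1 R" "p1 \<subset> p" "p1 \<noteq> {\<zero>}"
    using two_le_prime_heightD[OF is_cring] by blast
  note content = affine_poly_coeff_ideal_iff[OF V f prime_idealD(1)]
  have "g \<in> coeff_ideal V p"
  proof (rule krull_principal_ideal_polynomials[OF affine_poly_closed[OF f] p(1) _ _ p1 g])
    show "range (affine_poly V f f0) \<subseteq> p" using content[OF p(1)] p(2) by blast
    show "p' = p" if "primeideal p' R" "range (affine_poly V f f0) \<subseteq> p'" "p' \<subseteq> p" for p'
      using min[rule_format, of p'] content[OF that(1)] that by blast
    show "\<exists>k::nat. indexed_const (affine_poly V f f0 m) [^]\<^bsub>mpoly_ring V\<^esub> k \<otimes>\<^bsub>mpoly_ring V\<^esub> g
        \<in> Idl\<^bsub>mpoly_ring V\<^esub> {affine_poly V f f0}" for m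
      by (rule affine_coeff_power_annihilates[OF V f g annih])
  qed
  thus ?thesis using coeff_ideal_mono[OF p(3), of V] by blast
qed

text \<open>
  Some \<open>f\<^sub>i\<close> is nonzero: otherwise \<open>g = 1\<close> satisfies the hypothesis of \<open>torsion_mem_coeff_ideal\<close> and
  would lie in \<open>q[T]\<close> for a prime \<open>q \<supseteq> J\<close>, which exists because \<open>J\<close> is proper.  The torsion modulo \<open>h\<close>
  with respect to such an \<open>f\<^sub>i\<close> is then the least prime over \<open>h\<close>.
\<close>

lemma (in noetherian_domain) affine_hypersurface_irreducible:
  fixes V :: "'v::linorder set"
  assumes V: "finite V" and f: "f \<in> V \<rightarrow> carrier R" "f0 \<in> carrier R"
    and proper: "Idl (insert f0 (f ` V)) \<noteq> carrier R"
    and height: "ideal_height R (Idl (insert f0 (f ` V))) \<ge> 2"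
  shows "irreducible_ring (mpoly_ring V Quot (Idl\<^bsub>mpoly_ring V\<^esub> {affine_poly V f f0}))"
proof -
  let ?P = "mpoly_ring V"
  let ?h = "affine_poly V f f0"
  let ?S = "\<lambda>i. carrier (mpoly_ring (V - {i}))"
  interpret P: domain ?P by (rule domain_mpoly_ring)
  interpret const: ring_hom_ring R ?P indexed_const by (rule indexed_const_hom_ring)
  have h: "?h \<in> carrier ?P" by (rule affine_poly_closed[OF f])
  define H where "H = Idl\<^bsub>?P\<^esub> {?h}"
  have H: "ideal H ?P" unfolding H_def using h by (intro P.genideal_ideal) simp
  have hH: "?h \<in> H" unfolding H_def by (rule P.genideal_self'[OF h])
  note torsion = torsion_mem_coeff_ideal[OF V f height, folded H_def]
  have gens: "insert f0 (f ` V) \<subseteq> carrier R" using f by auto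
  have fR: "f i \<in> carrier R" if "i \<in> V" for i using f(1) that by blast
  have fP: "indexed_const (f i) \<in> carrier ?P" if "i \<in> V" for i by (rule indexed_const_closed[OF fR[OF that]])
  have zero_annih: "\<exists>k::nat. indexed_const (f i) [^]\<^bsub>?P\<^esub> k \<otimes>\<^bsub>?P\<^esub> g \<in> H"
    if "f i = \<zero>" "g \<in> carrier ?P" for i g
  proof -
    have "indexed_const (f i) [^]\<^bsub>?P\<^esub> (1::nat) \<otimes>\<^bsub>?P\<^esub> g = \<zero>\<^bsub>?P\<^esub>"
      using that by simp
    thus ?thesis using P.ideal_closed(2)[OF H] by metis
  qed
  obtain i where i: "i \<in> V" "f i \<noteq> \<zero>"
  proof (rule ccontr)
    assume "\<not> thesis"
    hence f0': "f i = \<zero>" if "i \<in> V" for i using that \<open>\<And>i. i \<in> V \<Longrightarrow> f i \<noteq> \<zero> \<Longrightarrow> thesis\<close> by blast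
    obtain q where q: "primeideal q R" "Idl (insert f0 (f ` V)) \<subseteq> q"
      using proper_ideal_le_prime[OF noetherian_ring_axioms genideal_ideal[OF gens] proper] by blast
    have "\<one>\<^bsub>?P\<^esub> \<in> coeff_ideal V q"
    proof (rule torsion[OF q(1) _ P.one_closed])
      show "insert f0 (f ` V) \<subseteq> q" using genideal_self[OF gens] q(2) by blast
    qed (rule zero_annih[OF f0' P.one_closed])
    moreover have "coeff_ideal V q \<noteq> carrier ?P" "ideal (coeff_ideal V q) ?P"
      using coeff_ideal_prime[OF q(1), of V] primeideal.I_notcarr[of "coeff_ideal V q" ?P] P.prime_idealD(1) by auto
    ultimately show False using ideal.one_imp_carrier by blast
  qed
  have S: "?S j \<subseteq> carrier ?P" for j using mpoly_mono_vars[of "V - {j}" V] by auto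
  have Smult: "x \<otimes>\<^bsub>?P\<^esub> y \<in> ?S j" if "x \<in> ?S j" "y \<in> ?S j" for x y j
    using monoid.m_closed[OF ring.is_monoid[OF cring.axioms(1)[OF cring_mpoly_ring]] that]
    by (simp add: mpoly_ring_simps)
  have Sconst: "indexed_const c \<in> ?S j" if "c \<in> carrier R" for c j
    using that by (rule indexed_const_closed)
  have const_nz: "indexed_const (f j) \<noteq> \<zero>\<^bsub>?P\<^esub>" if "f j \<noteq> \<zero>" for j
    using that by (auto simp: mpoly_ring_simps indexed_const_def fun_eq_iff)
  have SH: "H \<inter> ?S j \<subseteq> {\<zero>\<^bsub>?P\<^esub>}"
    and elim: "\<And>g. g \<in> carrier ?P \<Longrightarrow> \<exists>d::nat. \<exists>G\<in>?S j.
      indexed_const (f j) [^]\<^bsub>?P\<^esub> d \<otimes>\<^bsub>?P\<^esub> g \<ominus>\<^bsub>?P\<^esub> G \<in> H"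
    if j: "j \<in> V" "f j \<noteq> \<zero>" for j
  proof -
    obtain h' where h': "h' \<in> ?S j"
      "?h = indexed_const (f j) \<otimes>\<^bsub>?P\<^esub> indexed_var j \<oplus>\<^bsub>?P\<^esub> h'"
      by (rule affine_poly_split[OF V j(1) f])
    show "H \<inter> ?S j \<subseteq> {\<zero>\<^bsub>?P\<^esub>}" unfolding H_def
      by (rule principal_ideal_meets_other_variables_trivially[OF j(1) fR[OF j(1)] j(2) h'])
    show "\<And>g. g \<in> carrier ?P \<Longrightarrow> \<exists>d::nat. \<exists>G\<in>?S j.
        indexed_const (f j) [^]\<^bsub>?P\<^esub> d \<otimes>\<^bsub>?P\<^esub> g \<ominus>\<^bsub>?P\<^esub> G \<in> H"
      unfolding H_def by (rule eliminate_variable[OF j(1) fR[OF j(1)] h'])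
  qed
  define Q0 where "Q0 = {g \<in> carrier ?P. \<exists>k::nat. indexed_const (f i) [^]\<^bsub>?P\<^esub> k \<otimes>\<^bsub>?P\<^esub> g \<in> H}"
  have oneS: "\<one>\<^bsub>?P\<^esub> \<in> ?S i" unfolding mpoly_ring_simps(4) by (rule Sconst[OF one_closed])
  have Q0: "primeideal Q0 ?P" unfolding Q0_def
    by (rule P.torsion_prime_by_elimination[where S = "?S i",
          OF H S Smult oneS SH[OF i] Sconst[OF fR[OF i(1)]] const_nz[OF i(2)] elim[OF i]])
  have HQ0: "H \<subseteq> Q0"
  proof
    fix x assume x: "x \<in> H"
    hence "x \<in> carrier ?P" "indexed_const (f i) [^]\<^bsub>?P\<^esub> (0::nat) \<otimes>\<^bsub>?P\<^esub> x \<in> H"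
      using P.ideal_closed(7)[OF H] by auto
    thus "x \<in> Q0" unfolding Q0_def by blast
  qed
  have "Q0 \<subseteq> Q" if Q: "primeideal Q ?P" "H \<subseteq> Q" for Q
  proof
    fix g assume "g \<in> Q0"
    then obtain k :: nat where g: "g \<in> carrier ?P" "indexed_const (f i) [^]\<^bsub>?P\<^esub> k \<otimes>\<^bsub>?P\<^esub> g \<in> H"
      by (auto simp: Q0_def)
    note Qi = P.prime_idealD(1)[OF Q(1)]
    have annih: "\<exists>d::nat. indexed_const (f j) [^]\<^bsub>?P\<^esub> d \<otimes>\<^bsub>?P\<^esub> g \<in> H" if j: "j \<in> V" for j
    proof (cases "f j = \<zero>")
      case False
      have "indexed_const (f i) [^]\<^bsub>?P\<^esub> k = indexed_const (f i [^] k)"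
        using const.hom_nat_pow[OF fR[OF i(1)]] by simp
      hence a: "indexed_const (f i) [^]\<^bsub>?P\<^esub> k \<in> ?S j" using Sconst fR[OF i(1)] by simp
      have a0: "indexed_const (f i) [^]\<^bsub>?P\<^esub> k \<noteq> \<zero>\<^bsub>?P\<^esub>"
        by (rule P.nat_pow_nonzero[OF fP[OF i(1)] const_nz[OF i(2)]])
      show ?thesis
        by (rule P.torsion_by_elimination[where S = "?S j",
              OF H S Smult SH[OF j False] Sconst[OF fR[OF j]] elim[OF j False] a a0 g])
    qed (use zero_annih g(1) in blast)
    show "g \<in> Q"
    proof (cases "\<exists>j\<in>V. indexed_const (f j) \<notin> Q")
      case True
      then obtain j where j: "j \<in> V" "indexed_const (f j) \<notin> Q" by blast
      obtain d :: nat where "indexed_const (f j) [^]\<^bsub>?P\<^esub> d \<otimes>\<^bsub>?P\<^esub> g \<in> Q"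
        using annih[OF j(1)] Q(2) by blast
      hence "indexed_const (f j) [^]\<^bsub>?P\<^esub> d \<in> Q \<or> g \<in> Q"
        using primeideal.I_prime[OF Q(1) P.nat_pow_closed[OF fP[OF j(1)]] g(1)] by blast
      thus ?thesis using P.prime_powD[OF Q(1) fP[OF j(1)]] j(2) by blast
    next
      case False
      define q where "q = {r \<in> carrier R. indexed_const r \<in> Q}"
      have q: "primeideal q R" unfolding q_def by (rule const.primeideal_vimage[OF is_cring Q(1)])
      have "indexed_const f0 \<in> Q"
        by (rule const_term_mem_ideal[OF f Qi]) (use False hH Q(2) in auto)
      hence "insert f0 (f ` V) \<subseteq> q" using False f by (auto simp: q_def)
      hence "g \<in> coeff_ideal V q" by (rule torsion[OF q _ g(1) annih])
      also have "coeff_ideal V q \<subseteq> Q" by (rule coeff_ideal_subset[OF Qi]) (simp add: q_def)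
      finally show ?thesis .
    qed
  qed
  thus ?thesis unfolding H_def[symmetric]
    by (rule irreducible_quotient[OF cring_mpoly_ring H Q0 HQ0])
qed

theorem theorem2p1:
  fixes R :: "('a, 'b) ring_scheme" (structure)
    and n :: nat
    and f :: "nat \<Rightarrow> 'a"
    and f0 :: 'a
  defines "P \<equiv> ring.mpoly_ring R {1..n}"
    and "J \<equiv> Idl (insert f0 (f ` {1..n}))"
  defines "h \<equiv> (\<Oplus>\<^bsub>P\<^esub>i\<in>{1..n}. ring.indexed_const R (f i) \<otimes>\<^bsub>P\<^esub> ring.indexed_var R i)
                \<oplus>\<^bsub>P\<^esub> ring.indexed_const R f0"
  assumes "noetherian_domain R"
    and "\<And>i. i \<in> {1..n} \<Longrightarrow> f i \<in> carrier R"
    and "f0 \<in> carrier R"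
    and "J \<noteq> carrier R"
    and "ideal_height R J \<ge> 2"
  shows "irreducible_ring (P Quot (Idl\<^bsub>P\<^esub> {h}))"
proof -
  interpret noetherian_domain R by fact
  have "h = affine_poly {1..n} f f0" unfolding h_def P_def affine_poly_def ..
  moreover have "f \<in> {1..n} \<rightarrow> carrier R" using assms(5) by blast
  ultimately show ?thesis
    using affine_hypersurface_irreducible[of "{1..n}" f f0] assms(6-8) unfolding P_def J_def by simp
qed

end
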